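(* Let $M,N\ge 0$ be integers with $M+N\ge 1$. Let $X_1,\ldots,X_M$ and $Y_1,\ldots,Y_N$ be independent random variables with $X_i\sim N(0,\sigma_{X_i}^2)$, $i=1,\ldots,M$, and $Y_j\sim N(0,\sigma_{Y_j}^2)$, $j=1,\ldots,N$. Let $X=X_1\cdots X_M$, $Y=Y_1\cdots Y_N$, and $Z=X/Y$. Then the probability density function $f_Z$ of $Z$ is given, for $z\in\mathbb{R}$, by $$f_Z(z)=\frac{2^{(N-M)/2}s_N}{\pi^{(M+N)/2}\sigma_M}\,G^{M,N}_{N,M}\bigg(\frac{2^Ns_N^2}{2^M\sigma_M^2}z^2\;\bigg|\;{0,\ldots,0\atop 0,\ldots,0}\bigg),$$ where there are $N$ upper parameters and $M$ lower parameters, all equal to $0$.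
   Context: All standard deviations $\sigma_{X_i},\sigma_{Y_j}$ are positive. Notation: $\sigma_M=\sigma_{X_1}\cdots\sigma_{X_M}$ and $s_N=\sigma_{Y_1}\cdots\sigma_{Y_N}$. Empty products are $1$: thus $\sigma_0=1$, $s_0=1$, $X=1$ when $M=0$, and $Y=1$ when $N=0$. The Meijer $G$-function is defined by the contour integral $$G^{m,n}_{p,q}\bigg(x\;\bigg|\;{a_1,\ldots,a_p\atop b_1,\ldots,b_q}\bigg)=\frac{1}{2\pi \mathrm{i}}\int_L\frac{\prod_{j=1}^m\Gamma(b_j-s)\prod_{j=1}^n\Gamma(1-a_j+s)}{\prod_{j=n+1}^p\Gamma(a_j-s)\prod_{j=m+1}^q\Gamma(1-b_j+s)}\,x^s\,\mathrm{d}s,$$ where the path $L$ separates the poles of the factors $\Gamma(b_j-s)$ from those of the factors $\Gamma(1-a_j+s)$, and empty products are $1$. For $x>0$ and the parameters used here, $L$ may be taken to be a vertical line $\mathrm{Re}\,s=c$ with $-1<c<0$, traversed from $c-\mathrm{i}\infty$ to $c+\mathrm{i}\infty$. At the single point $z=0$ the right-hand side is understood as a (possibly infinite) limit as $z\to0$; the value of a density at one point is immaterial. *)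

theory Defs
  imports "HOL-Probability.Probability" "HOL-Complex_Analysis.Complex_Analysis"
begin

(* Lists are indexed from 0, so a_(j+1) is a ! j; p and q are the list lengths.
   Gamma is 0 at its poles and division by 0 gives 0, so the quotient vanishes at poles of
   the denominator, in accordance with 1/Gamma being entire. *)
definition meijer_integrand ::
    "nat \<Rightarrow> nat \<Rightarrow> complex list \<Rightarrow> complex list \<Rightarrow> complex \<Rightarrow> complex \<Rightarrow> complex" where
  "meijer_integrand m n a b x s =
     (\<Prod>j<m. Gamma (b ! j - s)) * (\<Prod>j<n. Gamma (1 - a ! j + s)) /
     ((\<Prod>j\<in>{n..<length a}. Gamma (a ! j - s)) * (\<Prod>j\<in>{m..<length b}. Gamma (1 - b ! j + s)))
     * x powr s"

(* The poles of Gamma are the elements of \<int>\<^sub>\<le>\<^sub>0. *)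
definition meijer_separating :: "nat \<Rightarrow> nat \<Rightarrow> complex list \<Rightarrow> complex list \<Rightarrow> real \<Rightarrow> bool" where
  "meijer_separating m n a b c \<longleftrightarrow>
     (\<forall>j<m. \<forall>s. b ! j - s \<in> \<int>\<^sub>\<le>\<^sub>0 \<longrightarrow> c < Re s) \<and>
     (\<forall>j<n. \<forall>s. 1 - a ! j + s \<in> \<int>\<^sub>\<le>\<^sub>0 \<longrightarrow> Re s < c)"

(* The contour runs along a vertical line Re s = c, from c - i*infinity to c + i*infinity.
   The value is the common limit over all separating lines; it is unspecified
   if there is no separating line, if the limit fails to exist on one of them, or if
   it depends on the line.  In particular contours that are not vertical lines are not covered. *)
definition meijer_G ::
    "nat \<Rightarrow> nat \<Rightarrow> complex list \<Rightarrow> complex list \<Rightarrow> complex \<Rightarrow> complex" where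
  "meijer_G m n a b x =
     (THE v. \<forall>c. meijer_separating m n a b c \<longrightarrow>
        ((\<lambda>T. 1 / (2 * of_real pi * \<i>) *
            contour_integral (linepath (Complex c (- T)) (Complex c T)) (meijer_integrand m n a b x))
          \<longlongrightarrow> v) at_top)"

end

theory Submission imports Defs begin

text \<open>The square of a centred normal variable is Gamma distributed, so the Mellin transform of the
  density of a single factor \<open>X\<^sub>i\<close> or \<open>1 / Y\<^sub>j\<close> is a Gamma function. Fourier inversion on a vertical line,
  carried out by inserting a Gaussian damping factor, turns this into an absolutely convergent
  Mellin--Barnes integral for the density of one factor. Multiplying by a further independent factor
  is a multiplicative convolution; by Fubini it inserts the Mellin transform of the new factor under
  the integral, on every admissible line at once. Hence the density of the product is a constant
  times the Meijer integral, whichever separating line is used. At \<open>0\<close> the limit exists because the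
  density is decreasing in \<open>\<bar>z\<bar>\<close> if there is a normal factor in the numerator, and because the line
  \<open>Re s = 1\<close> gives the bound \<open>O(z\<^sup>2)\<close> otherwise.\<close>

section \<open>Change of variables and Fourier inversion\<close>

text \<open>Borel functions have the same integrals over \<open>lebesgue\<close> and
  \<open>lborel\<close>, so the change of variables for absolutely integrable functions carries
  over. Without integrability both Bochner integrals default to 0, hence the equation is
  unconditional.\<close>

lemma lborel_change_of_variables:
  fixes f :: "real \<Rightarrow> 'a::euclidean_space" and g g' :: "real \<Rightarrow> real"
  assumes [measurable]: "S \<in> sets borel" "g ` S \<in> sets borel"
      "f \<in> borel_measurable borel" "g \<in> borel_measurable borel" "g' \<in> borel_measurable borel"
    and der: "\<And>x. x \<in> S \<Longrightarrow> (g has_field_derivative g' x) (at x)"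
    and inj: "inj_on g S"
  shows "set_integrable lborel S (\<lambda>x. \<bar>g' x\<bar> *\<^sub>R f (g x)) \<longleftrightarrow> set_integrable lborel (g ` S) f"
    and "(LINT x:S|lborel. \<bar>g' x\<bar> *\<^sub>R f (g x)) = (LINT y:g ` S|lborel. f y)"
proof -
  let ?F = "\<lambda>x. \<bar>g' x\<bar> *\<^sub>R f (g x)"
  have conv: "set_integrable lebesgue A h \<longleftrightarrow> set_integrable lborel A h"
      "(LINT x:A|lebesgue. h x) = (LINT x:A|lborel. h x)"
    if [measurable]: "A \<in> sets borel" "h \<in> borel_measurable borel" for A and h :: "real \<Rightarrow> 'a"
    unfolding set_integrable_def set_lebesgue_integral_def
    by (intro integrable_completion integral_completion; measurable)+
  have cov: "?F absolutely_integrable_on S \<and> integral S ?F = b \<longleftrightarrow>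
      f absolutely_integrable_on g ` S \<and> integral (g ` S) f = b" for b
    by (rule has_absolute_integral_change_of_variables_real)
       (auto intro: inj DERIV_subset[OF der])
  show int: "set_integrable lborel S ?F \<longleftrightarrow> set_integrable lborel (g ` S) f"
    using cov by (subst (1 2) conv[symmetric]) auto
  show "(LINT x:S|lborel. ?F x) = (LINT y:g ` S|lborel. f y)"
  proof (cases "set_integrable lborel S ?F")
    case True
    with int have *: "set_integrable lebesgue S ?F" "set_integrable lebesgue (g ` S) f"
      by (subst conv; simp)+
    then have "integral S ?F = integral (g ` S) f"
      using cov by blast
    then show ?thesis
      using * by (simp add: conv(2)[symmetric] set_lebesgue_integral_eq_integral)
  next
    case False
    with int show ?thesis
      by (simp add: set_integrable_def set_lebesgue_integral_def not_integrable_integral_eq)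
  qed
qed

text \<open>Rescaling \<open>t\<close> by \<open>1 / e\<close> reduces this to the characteristic
  function of the standard normal distribution.\<close>

lemma fourier_gaussian:
  fixes y e :: real
  assumes "e > 0"
  shows "(LINT t|lborel. iexp (t * y) * of_real (exp (- (e * t)\<^sup>2 / 2))) =
    of_real (sqrt (2 * pi) / e * exp (- (y / e)\<^sup>2 / 2))"
proof -
  have "(LINT t|lborel. iexp (t * y) * of_real (exp (- (e * t)\<^sup>2 / 2))) =
      (1 / e) *\<^sub>R (LINT t|lborel. iexp (t * (y / e)) * of_real (exp (- t\<^sup>2 / 2)))"
    using assms by (subst lborel_integral_real_affine[of "1 / e" _ 0])
       (simp_all add: power_mult_distrib mult_ac)
  also have "(LINT t|lborel. iexp (t * (y / e)) * of_real (exp (- t\<^sup>2 / 2))) =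
      of_real (sqrt (2 * pi)) *
        (LINT t|lborel. std_normal_density t *\<^sub>R iexp ((y / e) * t))"
    unfolding std_normal_density_def
    by (subst integral_mult_right_zero[symmetric], rule Bochner_Integration.integral_cong)
       (auto simp: scaleR_conv_of_real mult_ac)
  also have "(LINT t|lborel. std_normal_density t *\<^sub>R iexp ((y / e) * t)) =
      char std_normal_distribution (y / e)"
    by (simp add: char_def integral_density)
  also have "\<dots> = of_real (exp (- ((y / e)\<^sup>2) / 2))"
    by (simp add: char_std_normal_distribution)
  finally show ?thesis
    by (simp add: scaleR_conv_of_real)
qed

lemma integrable_gaussian:
  fixes e :: real
  assumes "e > 0"
  shows "integrable lborel (\<lambda>t. exp (- (e * t)\<^sup>2 / 2))"
proof -
  have "integrable lborel (\<lambda>t. sqrt (2 * pi) * std_normal_density (0 + e * t))"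
    by (intro integrable_mult_right lborel_integrable_real_affine) (use assms in auto)
  then show ?thesis
    by (simp add: std_normal_density_def)
qed

text \<open>The double integral behind the left-hand side does not converge absolutely. A factor
  \<open>exp (- (e * t)^2 / 2)\<close> makes Fubini applicable, and dominated convergence removes it
  on both sides as \<open>e\<close> tends to 0.\<close>

lemma fourier_inversion:
  fixes g :: "real \<Rightarrow> complex" and x :: real
  defines "\<phi> \<equiv> \<lambda>t. LINT y|lborel. iexp (t * y) * g y"
  assumes int: "integrable lborel g" and cont: "\<And>y. isCont g y"
    and bound: "\<And>y. norm (g y) \<le> B" and int': "integrable lborel \<phi>"
  shows "(LINT t|lborel. iexp (- (t * x)) * \<phi> t) = of_real (2 * pi) * g x"
proof -
  define e :: "nat \<Rightarrow> real" where "e n = inverse (real (Suc n))" for n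
  have e: "e n > 0" for n by (simp add: e_def)
  have e0: "e \<longlonglongrightarrow> 0"
    unfolding e_def by (rule LIMSEQ_inverse_real_of_nat)
  have [measurable]: "g \<in> borel_measurable borel" "\<phi> \<in> borel_measurable borel"
    using int int' by auto
  \<comment> \<open>After Fubini the \<open>t\<close>-integral is \<open>fourier_gaussian\<close> at
    \<open>y - x\<close>; the substitution \<open>y = x + e n * v\<close> then absorbs the factor
    \<open>1 / e n\<close>.\<close>
  have J: "(LINT t|lborel. iexp (- (t * x)) * \<phi> t * of_real (exp (- (e n * t)\<^sup>2 / 2))) =
      (LINT v|lborel. g (x + e n * v) * of_real (sqrt (2 * pi) * exp (- v\<^sup>2 / 2)))" for n
  proof -
    let ?G = "\<lambda>t. exp (- (e n * t)\<^sup>2 / 2)"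
    have "integrable (lborel \<Otimes>\<^sub>M lborel)
        (\<lambda>(t, y). iexp (t * (y - x)) * (g y * of_real (?G t)))"
    proof (rule lborel_pair.Fubini_integrable)
      show "integrable lborel (\<lambda>t. LINT y|lborel.
          norm (case (t, y) of (t, y) \<Rightarrow> iexp (t * (y - x)) * (g y * of_real (?G t))))"
        using integrable_gaussian[OF e, of n] by (simp add: norm_mult)
      show "AE t in lborel. integrable lborel
          (\<lambda>y. case (t, y) of (t, y) \<Rightarrow> iexp (t * (y - x)) * (g y * of_real (?G t)))"
        by (intro always_eventually allI Bochner_Integration.integrable_bound
              [OF integrable_mult_left[OF int, of "of_real (?G _)"]])
           (auto simp: norm_mult)
    qed measurable
    note fub = lborel_pair.Fubini_integral[OF this]
    have "(LINT t|lborel. iexp (- (t * x)) * \<phi> t * of_real (?G t)) =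
        (LINT t|lborel. LINT y|lborel. iexp (t * (y - x)) * (g y * of_real (?G t)))"
    proof (rule Bochner_Integration.integral_cong[OF refl])
      fix t
      have "iexp (- (t * x)) * \<phi> t * of_real (?G t) =
          (LINT y|lborel. iexp (- (t * x)) * (iexp (t * y) * g y) * of_real (?G t))"
        unfolding \<phi>_def by simp
      also have "\<dots> = (LINT y|lborel. iexp (t * (y - x)) * (g y * of_real (?G t)))"
        by (rule Bochner_Integration.integral_cong[OF refl])
           (simp add: right_diff_distrib exp_diff exp_minus divide_simps)
      finally show "iexp (- (t * x)) * \<phi> t * of_real (?G t) =
          (LINT y|lborel. iexp (t * (y - x)) * (g y * of_real (?G t)))" .
    qed
    also have "\<dots> = (LINT y|lborel. LINT t|lborel. iexp (t * (y - x)) * (g y * of_real (?G t)))"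
      by (rule fub[symmetric])
    also have "\<dots> = (LINT y|lborel. g y * of_real (sqrt (2 * pi) / e n * exp (- ((y - x) / e n)\<^sup>2 / 2)))"
      by (subst fourier_gaussian[OF e, symmetric], subst integral_mult_right_zero[symmetric])
         (auto intro!: Bochner_Integration.integral_cong simp: mult_ac)
    also have "\<dots> = e n *\<^sub>R (LINT v|lborel. g (x + e n * v) *
        of_real (sqrt (2 * pi) / e n * exp (- v\<^sup>2 / 2)))"
      using e[of n] by (subst lborel_integral_real_affine[of "e n" _ x]) auto
    also have "\<dots> = (LINT v|lborel. g (x + e n * v) * of_real (sqrt (2 * pi) * exp (- v\<^sup>2 / 2)))"
      using e[of n] by (subst integral_scaleR_right[symmetric])
        (auto intro!: Bochner_Integration.integral_cong simp: scaleR_conv_of_real field_simps)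
    finally show ?thesis .
  qed
  have L: "(\<lambda>n. LINT t|lborel. iexp (- (t * x)) * \<phi> t * of_real (exp (- (e n * t)\<^sup>2 / 2)))
      \<longlonglongrightarrow> (LINT t|lborel. iexp (- (t * x)) * \<phi> t)"
  proof (rule integral_dominated_convergence)
    show "integrable lborel (\<lambda>t. norm (\<phi> t))"
      using int' by simp
    have "(\<lambda>n. iexp (- (t * x)) * \<phi> t * of_real (exp (- (e n * t)\<^sup>2 / 2)))
      \<longlonglongrightarrow> iexp (- (t * x)) * \<phi> t * of_real (exp (- (0 * t)\<^sup>2 / 2))" for t
      by (intro tendsto_intros e0) auto
    then show "AE t in lborel. (\<lambda>n. iexp (- (t * x)) * \<phi> t * of_real (exp (- (e n * t)\<^sup>2 / 2)))
      \<longlonglongrightarrow> iexp (- (t * x)) * \<phi> t"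
      by simp
    show "AE t in lborel. norm (iexp (- (t * x)) * \<phi> t * of_real (exp (- (e n * t)\<^sup>2 / 2)))
        \<le> norm (\<phi> t)" for n
      by (auto simp: norm_mult intro!: always_eventually mult_left_le)
  qed measurable
  have R: "(\<lambda>n. LINT v|lborel. g (x + e n * v) * of_real (sqrt (2 * pi) * exp (- v\<^sup>2 / 2)))
      \<longlonglongrightarrow> (LINT v|lborel. g x * of_real (sqrt (2 * pi) * exp (- v\<^sup>2 / 2)))"
  proof (rule integral_dominated_convergence)
    show "integrable lborel (\<lambda>v. B * (sqrt (2 * pi) * exp (- v\<^sup>2 / 2)))"
      using integrable_gaussian[of 1] by (intro integrable_mult_right) auto
    have "(\<lambda>n. x + e n * v) \<longlonglongrightarrow> x + 0 * v" for v
      by (intro tendsto_intros e0)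
    then have "(\<lambda>n. g (x + e n * v)) \<longlonglongrightarrow> g x" for v
      by (intro isCont_tendsto_compose[OF cont]) simp
    then show "AE v in lborel. (\<lambda>n. g (x + e n * v) * of_real (sqrt (2 * pi) * exp (- v\<^sup>2 / 2)))
        \<longlonglongrightarrow> g x * of_real (sqrt (2 * pi) * exp (- v\<^sup>2 / 2))"
      by (intro always_eventually allI tendsto_mult_right)
    show "AE v in lborel. norm (g (x + e n * v) * of_real (sqrt (2 * pi) * exp (- v\<^sup>2 / 2)))
        \<le> B * (sqrt (2 * pi) * exp (- v\<^sup>2 / 2))" for n
      using bound by (auto simp: norm_mult intro!: always_eventually mult_right_mono)
  qed measurable
  \<comment> \<open>One factor \<open>sqrt (2 * pi)\<close> comes from the transform, the other is
    the mass of the Gaussian in \<open>v\<close>.\<close>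
  have "(LINT v|lborel. g x * of_real (sqrt (2 * pi) * exp (- v\<^sup>2 / 2))) = g x * of_real (2 * pi)"
    using fourier_gaussian[of 1 0] by (simp flip: of_real_mult)
  with LIMSEQ_unique[OF L] R J show ?thesis
    by (simp add: mult.commute)
qed

section \<open>The Gamma function on vertical lines\<close>

text \<open>Euler's integral under \<open>t = exp x\<close>, whose Jacobian raises the exponent from
  \<open>z - 1\<close> to \<open>z\<close>. On a vertical line it shows Gamma as the Fourier
  transform of \<open>exp (a * x - exp x)\<close>.\<close>

lemma Gamma_exp_integral:
  assumes "Re z > 0"
  shows "integrable lborel (\<lambda>x. exp (z * of_real x - of_real (exp x)))"
    and "(LINT x|lborel. exp (z * of_real x - of_real (exp x))) = Gamma z"
proof -
  define f where "f t = exp ((z - 1) * of_real (ln t) - of_real t)" for t :: real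
  have [measurable]: "f \<in> borel_measurable borel"
    unfolding f_def by measurable
  have eq: "complex_of_real t powr (z - 1) / of_real (exp t) = f t" if "t \<in> {0<..}" for t
    using that by (simp add: f_def powr_def Ln_of_real exp_diff exp_of_real)
  have abs: "f absolutely_integrable_on {0<..}"
    using absolutely_integrable_Gamma_integral'[OF assms]
    by (subst (asm) set_integrable_cong[OF refl refl eq])
  have "(f has_integral Gamma z) {0<..}"
    using Gamma_integral_complex'[OF assms] by (subst (asm) has_integral_cong[OF eq])
  then have "(LINT x:{0<..}|lebesgue. f x) = Gamma z"
    using abs by (simp add: set_lebesgue_integral_eq_integral integral_unique)
  then have lb: "set_integrable lborel {0<..} f" "(LINT x:{0<..}|lborel. f x) = Gamma z"
    using abs unfolding set_integrable_def set_lebesgue_integral_def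
    by (simp_all add: integrable_completion integral_completion)
  have im: "exp ` (UNIV :: real set) = {0<..}"
    by (auto simp: image_iff) (metis exp_ln)
  have F: "\<bar>exp x\<bar> *\<^sub>R f (exp x) = exp (z * of_real x - of_real (exp x))" for x
    by (simp add: f_def scaleR_conv_of_real exp_of_real[symmetric] exp_add[symmetric] algebra_simps)
  have der: "(exp has_field_derivative exp x) (at x)" for x :: real
    by (rule DERIV_exp)
  note cov = lborel_change_of_variables[of UNIV exp f exp, unfolded im, simplified F]
  show "integrable lborel (\<lambda>x. exp (z * of_real x - of_real (exp x)))"
    using cov(1) lb(1) der by (simp add: set_integrable_def inj_on_def)
  show "(LINT x|lborel. exp (z * of_real x - of_real (exp x))) = Gamma z"
    using cov(2) lb(2) der by (simp add: set_lebesgue_integral_def inj_on_def)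
qed

text \<open>The modulus of the integrand in \<open>Gamma_exp_integral\<close> depends only on
  \<open>Re z\<close>, which bounds Gamma uniformly on a vertical line.\<close>

lemma norm_Gamma_le:
  assumes "Re z > 0"
  shows "norm (Gamma z) \<le> norm (Gamma (of_real (Re z) :: complex))"
proof -
  have *: "(LINT x|lborel. complex_of_real (exp (Re z * x - exp x))) = Gamma (of_real (Re z))"
    using Gamma_exp_integral(2)[of "of_real (Re z)"] assms
    by (simp add: exp_of_real flip: of_real_mult of_real_diff)
  have "norm (Gamma z) \<le> (LINT x|lborel. exp (Re z * x - exp x))"
    using integral_norm_bound[of lborel "\<lambda>x. exp (z * of_real x - of_real (exp x))"]
    by (simp add: Gamma_exp_integral(2)[OF assms])
  also have "\<dots> \<le> norm (complex_of_real (LINT x|lborel. exp (Re z * x - exp x)))"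
    unfolding norm_of_real by (rule abs_ge_self)
  also have "\<dots> = norm (Gamma (of_real (Re z) :: complex))"
    using * by simp
  finally show ?thesis .
qed

text \<open>Two uses of the functional equation give
  \<open>Gamma z = Gamma (z + 2) / (z * (z + 1))\<close>; the numerator is bounded on the line and
  the denominator grows quadratically, so no Stirling estimate is involved.\<close>

lemma integrable_Gamma_line:
  assumes "a > 0"
  shows "integrable lborel (\<lambda>t. Gamma (Complex a t))"
proof (rule Bochner_Integration.integrable_bound)
  define B where "B = norm (Gamma (of_real (a + 2) :: complex)) / min (a\<^sup>2) 1"
  show "integrable lborel (\<lambda>t. B * inverse (1 + t\<^sup>2))"
    using integrable_inverse_1_plus_square by (intro integrable_mult_right) (simp add: set_integrable_def)
  have "continuous_on UNIV (\<lambda>t. Gamma (Complex a t))"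
    unfolding Complex_eq using assms
    by (intro continuous_at_imp_continuous_on ballI isCont_Gamma continuous_intros)
       (auto elim!: nonpos_Ints_cases simp: complex_eq_iff)
  then show "(\<lambda>t. Gamma (Complex a t)) \<in> borel_measurable lborel"
    using borel_measurable_continuous_onI by auto
  have "norm (Gamma (Complex a t)) \<le> B * inverse (1 + t\<^sup>2)" for t
  proof -
    let ?z = "Complex a t"
    have nz: "?z \<noteq> 0" "?z + 1 \<noteq> 0"
      using assms by (auto simp: complex_eq_iff)
    have "?z \<notin> \<int>\<^sub>\<le>\<^sub>0" "?z + 1 \<notin> \<int>\<^sub>\<le>\<^sub>0"
      using assms by (auto elim!: nonpos_Ints_cases simp: complex_eq_iff)
    then have "Gamma (?z + 2) = (?z + 1) * (?z * Gamma ?z)"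
      using Gamma_plus1[of ?z] Gamma_plus1[of "?z + 1"] by (simp add: add.assoc)
    then have "norm (Gamma ?z) * (norm (?z + 1) * norm ?z) = norm (Gamma (?z + 2))"
      by (simp add: norm_mult)
    also have "\<dots> \<le> norm (Gamma (of_real (a + 2) :: complex))"
      using norm_Gamma_le[of "?z + 2"] assms by simp
    finally have 1: "norm (Gamma ?z) * (norm (?z + 1) * norm ?z)
        \<le> norm (Gamma (of_real (a + 2) :: complex))" .
    have "min (a\<^sup>2) 1 * (1 + t\<^sup>2) \<le> a\<^sup>2 + t\<^sup>2"
      using mult_right_mono[of "min (a\<^sup>2) 1" 1 "t\<^sup>2"] by (simp add: distrib_left)
    also have "\<dots> = norm ?z * norm ?z"
      by (simp add: cmod_def)
    also have "\<dots> \<le> norm (?z + 1) * norm ?z"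
      using assms by (intro mult_right_mono) (auto simp: cmod_def intro!: power_mono)
    finally have "norm (Gamma ?z) * (min (a\<^sup>2) 1 * (1 + t\<^sup>2)) \<le>
        norm (Gamma (of_real (a + 2) :: complex))"
      using 1 by (meson mult_left_mono norm_ge_zero order_trans)
    moreover have "min (a\<^sup>2) 1 > 0" "1 + t\<^sup>2 > 0"
      using assms by (auto simp: add_pos_nonneg)
    ultimately show ?thesis
      unfolding B_def by (simp add: pos_le_divide_eq mult.assoc flip: divide_inverse)
  qed
  then show "AE t in lborel. norm (Gamma (Complex a t)) \<le> norm (B * inverse (1 + t\<^sup>2))"
    by (auto intro!: always_eventually order_trans[OF _ abs_ge_self])
qed

lemma Gamma_line_inversion:
  assumes "a > 0"
  shows "(LINT t|lborel. Gamma (Complex a t) * iexp (- (t * x))) =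
    of_real (2 * pi * exp (a * x - exp x))"
proof -
  define g where "g y = complex_of_real (exp (a * y - exp y))" for y
  have \<phi>: "(LINT y|lborel. iexp (t * y) * g y) = Gamma (Complex a t)" for t
  proof -
    have "iexp (t * y) * g y = exp (Complex a t * of_real y - of_real (exp y))" for y
      by (simp add: g_def Complex_eq algebra_simps flip: exp_of_real exp_add)
    then show ?thesis
      using Gamma_exp_integral(2)[of "Complex a t"] assms by simp
  qed
  have "(LINT t|lborel. iexp (- (t * x)) * (LINT y|lborel. iexp (t * y) * g y)) =
      of_real (2 * pi) * g x"
  proof (rule fourier_inversion)
    show "integrable lborel g"
      using Gamma_exp_integral(1)[of "of_real a"] assms
      by (simp add: g_def[abs_def] exp_of_real flip: of_real_mult of_real_diff)
    show "isCont g y" for y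
      unfolding g_def by (intro continuous_intros)
    \<comment> \<open>The exponent \<open>a * y - exp y\<close> is largest at
      \<open>y = ln a\<close>; the bound is \<open>1 + u \<le> exp u\<close> at
      \<open>u = y - ln a\<close>.\<close>
    show "norm (g y) \<le> exp (a * ln a - a)" for y
    proof -
      have "a * (1 + (y - ln a)) \<le> a * exp (y - ln a)"
        using assms by (intro mult_left_mono exp_ge_add_one_self) auto
      then have "a * y - exp y \<le> a * ln a - a"
        using assms by (simp add: exp_diff algebra_simps)
      then show ?thesis
        by (simp add: g_def)
    qed
    show "integrable lborel (\<lambda>t. LINT y|lborel. iexp (t * y) * g y)"
      unfolding \<phi> using assms by (rule integrable_Gamma_line)
  qed
  then show ?thesis
    unfolding \<phi> by (simp add: g_def mult.commute)
qed

text \<open>On each half-line \<open>l\<close> is a bijection onto the reals with derivative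
  \<open>2 * k / u\<close>, so substituting \<open>x = l u\<close> in
  \<open>Gamma_exp_integral\<close> yields half of \<open>Gamma w\<close> from each side.\<close>

lemma Gamma_logsquare_integral:
  fixes k b :: real
  assumes "Re w > 0" "\<bar>k\<bar> = 1"
  defines "l \<equiv> \<lambda>u. b + k * ln (u\<^sup>2)"
  shows "integrable lborel (\<lambda>u. (1 / \<bar>u\<bar>) *\<^sub>R exp (w * of_real (l u) - of_real (exp (l u))))"
    and "(LINT u|lborel. (1 / \<bar>u\<bar>) *\<^sub>R exp (w * of_real (l u) - of_real (exp (l u)))) = Gamma w"
proof -
  define f where "f x = exp (w * of_real x - of_real (exp x))" for x :: real
  let ?F = "\<lambda>u. (1 / \<bar>u\<bar>) *\<^sub>R f (l u)"
  have [measurable]: "f \<in> borel_measurable borel" "l \<in> borel_measurable borel"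
    unfolding f_def l_def by measurable
  have kk: "k * k = 1" and k0: "k \<noteq> 0"
    using assms(2) by (auto simp: abs_if split: if_splits)
  have half: "set_integrable lborel S ?F" "(LINT u:S|lborel. ?F u) = (1/2) *\<^sub>R Gamma w"
    if S: "S \<in> sets borel" "S = (\<lambda>u. e * u) ` {0<..}" "\<bar>e\<bar> = 1" for S and e :: real
  proof -
    have S0: "u \<noteq> 0" if "u \<in> S" for u
      using that S by auto
    have e2: "e\<^sup>2 = 1"
      using S(3) by (simp add: abs_square_eq_1)
    have im: "l ` S = UNIV"
    proof -
      \<comment> \<open>The preimage of \<open>y\<close> under \<open>l\<close> in this half-line;
        since \<open>k * k = 1\<close>, multiplying by \<open>k\<close> replaces dividing by
        it.\<close>
      have "y = l (e * exp (k * (y - b) / 2))" for y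
        using kk e2 by (simp add: l_def power_mult_distrib flip: exp_double power2_eq_square)
           (simp add: mult.assoc[symmetric] flip: power2_eq_square)
      moreover have "e * exp (k * (y - b) / 2) \<in> S" for y
        unfolding S by (intro imageI) simp
      ultimately show ?thesis by blast
    qed
    have inj: "inj_on l S"
    proof (rule inj_onI)
      fix x y assume xy: "x \<in> S" "y \<in> S" "l x = l y"
      then have "ln (x\<^sup>2) = ln (y\<^sup>2)"
        using k0 by (simp add: l_def)
      then have "x\<^sup>2 = y\<^sup>2"
        using xy S0 by (subst (asm) ln_inj_iff) auto
      moreover obtain u v where "x = e * u" "y = e * v" "u > 0" "v > 0"
        using xy S(2) by auto
      ultimately show "x = y"
        using e2 by (simp add: power_mult_distrib)
    qed
    have der: "(l has_field_derivative (2 * k / u)) (at u)" if "u \<in> S" for u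
      unfolding l_def using S0[OF that]
      by (auto intro!: derivative_eq_intros simp: power2_eq_square zero_less_mult_iff)
    note cov = lborel_change_of_variables[of S l f "\<lambda>u. 2 * k / u", unfolded im, OF S(1) _ _ _ _ der inj]

    have f: "set_integrable lborel UNIV f" "(LINT x:UNIV|lborel. f x) = Gamma w"
      using Gamma_exp_integral[OF assms(1)]
      by (simp_all add: f_def set_integrable_def set_lebesgue_integral_def)
    have int2: "set_integrable lborel S (\<lambda>u. 2 *\<^sub>R ?F u)"
      and val2: "(LINT u:S|lborel. 2 *\<^sub>R ?F u) = Gamma w"
      using cov f assms(2) by (simp_all add: abs_mult)
    show "set_integrable lborel S ?F"
      using set_integrable_scaleR_right[of "1/2", OF int2] by simp
    show "(LINT u:S|lborel. ?F u) = (1/2) *\<^sub>R Gamma w"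
      unfolding val2[symmetric] set_integral_scaleR_right by (simp only: scaleR_scaleR) simp
  qed
  have neg: "{..<0} = (\<lambda>u. -1 * u) ` {0::real<..}"
    using surj_uminus by (auto simp: image_iff intro: exI[of _ "- _"])
  have pos: "{0<..} = (\<lambda>u. 1 * u) ` {0::real<..}"
    by auto
  note N = half[OF _ neg] and P = half[OF _ pos]
  have U: "set_integrable lborel ({..<0} \<union> {0<..}) ?F"
    by (rule set_integrable_Un) (use N P in auto)
  have V: "(LINT u:{..<0} \<union> {0<..}|lborel. ?F u) = Gamma w"
    by (subst set_integral_Un) (use N P in \<open>auto simp flip: scaleR_add_left\<close>)
  \<comment> \<open>At \<open>u = 0\<close> both sides are 0 because
    \<open>1 / \<bar>0\<bar> = 0\<close>.\<close>
  have eq: "indicator ({..<0} \<union> {0<..}) u *\<^sub>R ?F u = ?F u" for u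
    by (cases "u = 0") (auto simp: indicator_def)
  show "integrable lborel (\<lambda>u. (1 / \<bar>u\<bar>) *\<^sub>R exp (w * of_real (l u) - of_real (exp (l u))))"
    using U unfolding set_integrable_def eq by (simp add: f_def)
  show "(LINT u|lborel. (1 / \<bar>u\<bar>) *\<^sub>R exp (w * of_real (l u) - of_real (exp (l u)))) = Gamma w"
    using V unfolding set_lebesgue_integral_def eq by (simp add: f_def)
qed

section \<open>Densities of normal and inverse normal variables\<close>

text \<open>The density of \<open>U\<close> when \<open>exp b * \<bar>U\<bar> powr (2 * k)\<close> has the Gamma distribution of shape \<open>1 / 2\<close> and \<open>U\<close> is
  symmetric; division by \<open>0\<close> makes it vanish at \<open>0\<close>, also for \<open>k = 1\<close>.\<close>

definition gauss_power_density :: "real \<Rightarrow> real \<Rightarrow> real \<Rightarrow> real" where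
  "gauss_power_density k b u =
     exp ((b + k * ln (u\<^sup>2)) / 2 - exp (b + k * ln (u\<^sup>2))) / (sqrt pi * \<bar>u\<bar>)"

lemma gauss_power_density_measurable [measurable]: "gauss_power_density k b \<in> borel_measurable borel"
  unfolding gauss_power_density_def by measurable

lemma gauss_power_density_nonneg: "gauss_power_density k b u \<ge> 0"
  by (simp add: gauss_power_density_def)

lemma gauss_power_density_0 [simp]: "gauss_power_density k b 0 = 0"
  by (simp add: gauss_power_density_def)

text \<open>This \<open>b\<close> gives \<open>exp (b + ln (u^2)) = u^2 / (2 * \<sigma>^2)\<close>.
  The point 0 is excluded since only the left-hand side vanishes there.\<close>

lemma gauss_power_density_normal:
  assumes "\<sigma> > 0" "u \<noteq> 0"
  shows "gauss_power_density 1 (- ln (2 * \<sigma>\<^sup>2)) u = normal_density 0 \<sigma> u"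
proof -
  let ?L = "- ln (2 * \<sigma>\<^sup>2) + ln (u\<^sup>2)"
  have L: "?L = ln (u\<^sup>2 / (2 * \<sigma>\<^sup>2))"
    using assms by (simp add: ln_div)
  have "exp ?L = u\<^sup>2 / (2 * \<sigma>\<^sup>2)"
    unfolding L using assms by (subst exp_ln) auto
  moreover have "exp (?L / 2) = \<bar>u\<bar> / (sqrt 2 * \<sigma>)"
    using assms unfolding L by (subst ln_sqrt[symmetric]) (auto simp: real_sqrt_divide real_sqrt_mult)
  ultimately show ?thesis
    using assms unfolding gauss_power_density_def normal_density_def mult_1 exp_diff
    by (simp only:) (simp add: real_sqrt_mult exp_minus field_simps)
qed

text \<open>Replacing \<open>k = 1\<close> by \<open>k = - 1\<close> amounts to \<open>u\<close>
  becoming \<open>1 / u\<close>, with Jacobian \<open>1 / u^2\<close>.\<close>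

lemma gauss_power_density_inverse_normal:
  assumes "\<sigma> > 0" "u \<noteq> 0"
  shows "gauss_power_density (- 1) (- ln (2 * \<sigma>\<^sup>2)) u = normal_density 0 \<sigma> (1 / u) / u\<^sup>2"
proof -
  have "gauss_power_density (- 1) b u = gauss_power_density 1 b (1 / u) / u\<^sup>2" for b
  proof -
    have *: "b + 1 * ln ((1 / u)\<^sup>2) = b + - 1 * ln (u\<^sup>2)"
      using assms by (simp add: power_divide ln_div)
    have "\<bar>1 / u\<bar> * u\<^sup>2 = \<bar>u\<bar>"
      using assms by (cases "u > 0") (auto simp: power2_eq_square)
    then show ?thesis
      unfolding gauss_power_density_def * by (simp only: divide_divide_eq_left mult.assoc)
  qed
  then show ?thesis
    using assms by (simp add: gauss_power_density_normal)
qed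

text \<open>Away from 0 this density is a constant times \<open>exp (- (exp b * u^2))\<close>. The
  default value 0 at the origin forces \<open>y \<noteq> 0\<close>.\<close>

lemma gauss_power_density_antimono:
  assumes "y \<noteq> 0" "\<bar>y\<bar> \<le> \<bar>z\<bar>"
  shows "gauss_power_density 1 b z \<le> gauss_power_density 1 b y"
proof -
  have eq: "gauss_power_density 1 b u = exp (b / 2) / sqrt pi * exp (- (exp b * u\<^sup>2))" if "u \<noteq> 0" for u
  proof -
    have "exp (ln (u\<^sup>2) / 2) = \<bar>u\<bar>"
      using that by (simp add: ln_sqrt[symmetric])
    moreover have "exp (ln (u\<^sup>2)) = u\<^sup>2"
      using that by simp
    moreover have "exp ((b + ln (u\<^sup>2)) / 2 - exp (b + ln (u\<^sup>2))) =
        exp (b / 2) * exp (ln (u\<^sup>2) / 2) * exp (- (exp b * exp (ln (u\<^sup>2))))"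
      by (simp only: mult_exp_exp add_divide_distrib diff_conv_add_uminus)
    ultimately show ?thesis
      using that unfolding gauss_power_density_def mult_1 by (simp only:) simp
  qed
  have "y\<^sup>2 \<le> z\<^sup>2" "z \<noteq> 0"
    using assms by (auto simp: abs_le_square_iff)
  then show ?thesis
    using assms by (simp add: eq divide_right_mono)
qed

text \<open>The Mellin transform of one factor. As \<open>k * k = 1\<close>, \<open>ln (u^2)\<close>
  equals \<open>k\<close> times the logarithmic variable minus \<open>k * b\<close>; the first term
  shifts the Gamma argument from \<open>1 / 2\<close> to \<open>1 / 2 - k * p\<close>, the second
  leaves \<open>exp (p * k * b)\<close>.\<close>

lemma gauss_power_density_moment:
  assumes "\<bar>k\<bar> = 1" "k * Re p < 1 / 2"
  shows "integrable lborel (\<lambda>u. gauss_power_density k b u *\<^sub>R exp (- (p * of_real (ln (u\<^sup>2)))))"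
    and "(LINT u|lborel. gauss_power_density k b u *\<^sub>R exp (- (p * of_real (ln (u\<^sup>2))))) =
      of_real (1 / sqrt pi) * Gamma (1 / 2 - of_real k * p) * exp (p * of_real (k * b))"
proof -
  let ?w = "1 / 2 - of_real k * p"
  let ?l = "\<lambda>u. b + k * ln (u\<^sup>2)"
  let ?C = "of_real (1 / sqrt pi) * exp (p * of_real (k * b))"
  have "k * k = 1"
    using assms(1) by (auto simp: abs_if split: if_splits)
  then have k2: "of_real k * of_real k = (1::complex)"
    by (metis of_real_1 of_real_mult)
  have eq: "gauss_power_density k b u *\<^sub>R exp (- (p * of_real (ln (u\<^sup>2)))) =
      ?C * ((1 / \<bar>u\<bar>) *\<^sub>R exp (?w * of_real (?l u) - of_real (exp (?l u))))" for u
  proof -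
    have "?w * of_real (?l u) = of_real (?l u / 2) - p * of_real (k * b)
        - p * of_real (ln (u\<^sup>2)) * (of_real k * of_real k)"
      by (simp add: algebra_simps)
    then have "?w * of_real (?l u) - of_real (exp (?l u)) =
        of_real (?l u / 2 - exp (?l u)) - p * of_real (k * b) - p * of_real (ln (u\<^sup>2))"
      unfolding k2 by simp
    then have "exp (?w * of_real (?l u) - of_real (exp (?l u))) =
        of_real (exp (?l u / 2 - exp (?l u))) * exp (- (p * of_real (ln (u\<^sup>2)))) / exp (p * of_real (k * b))"
      by (simp only: exp_diff exp_of_real exp_minus divide_inverse mult_ac)
    then show ?thesis
      by (simp only:) (simp add: gauss_power_density_def scaleR_conv_of_real)
  qed
  have w: "Re ?w > 0"
    using assms by simp
  show "integrable lborel (\<lambda>u. gauss_power_density k b u *\<^sub>R exp (- (p * of_real (ln (u\<^sup>2)))))"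
    unfolding eq by (intro integrable_mult_right Gamma_logsquare_integral(1) w assms)
  show "(LINT u|lborel. gauss_power_density k b u *\<^sub>R exp (- (p * of_real (ln (u\<^sup>2))))) =
      of_real (1 / sqrt pi) * Gamma (1 / 2 - of_real k * p) * exp (p * of_real (k * b))"
    unfolding eq integral_mult_right_zero Gamma_logsquare_integral(2)[OF w assms(1)]
    by (simp add: mult_ac)
qed

lemma integrable_Gamma_mellin_line:
  assumes "\<bar>k\<bar> = 1" "k * c < 1 / 2"
  shows "integrable lborel (\<lambda>t. Gamma (1 / 2 - of_real k * Complex c t))"
proof -
  have "1 / 2 - of_real k * Complex c t = Complex (1 / 2 - k * c) (0 + (- k) * t)" for t
    by (simp add: complex_eq_iff)
  then show ?thesis
    using lborel_integrable_real_affine[OF integrable_Gamma_line[of "1 / 2 - k * c"], of "- k" 0] assms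
    by auto
qed

text \<open>Mellin inversion for one factor, by \<open>Gamma_line_inversion\<close> with
  \<open>a = 1 / 2 - k * c\<close>. The dependence on \<open>c\<close> cancels because
  \<open>c * k + a = 1 / 2\<close>, so every admissible line gives the same value.\<close>

lemma gauss_power_density_inversion:
  assumes "\<bar>k\<bar> = 1" "k * c < 1 / 2" "z \<noteq> 0"
  shows "of_real (\<bar>z\<bar> * gauss_power_density k b z) = of_real (1 / (sqrt pi * (2 * pi))) *
    (LINT t|lborel. Gamma (1 / 2 - of_real k * Complex c t) *
       exp (Complex c t * of_real (ln (z\<^sup>2) + k * b)))"
proof -
  let ?l = "b + k * ln (z\<^sup>2)"
  let ?a = "1 / 2 - k * c"
  have kk: "k * k = 1"
    using assms(1) by (auto simp: abs_if split: if_splits)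
  have "(LINT t|lborel. Gamma (1 / 2 - of_real k * Complex c t) *
       exp (Complex c t * of_real (ln (z\<^sup>2) + k * b))) =
      (LINT t|lborel. exp (of_real (c * k * ?l)) *
        (Gamma (Complex ?a (0 + (- k) * t)) * iexp (- ((0 + (- k) * t) * ?l))))"
  proof (rule Bochner_Integration.integral_cong[OF refl])
    fix t
    have "ln (z\<^sup>2) + k * b = k * ?l"
      using kk by (simp add: distrib_left flip: mult.assoc)
    then have "Complex c t * of_real (ln (z\<^sup>2) + k * b) =
        of_real (c * k * ?l) + \<i> * of_real (- ((0 + (- k) * t) * ?l))"
      by (simp add: complex_eq_iff)
    moreover have "1 / 2 - of_real k * Complex c t = Complex ?a (0 + (- k) * t)"
      by (simp add: complex_eq_iff)
    ultimately show "Gamma (1 / 2 - of_real k * Complex c t) *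
        exp (Complex c t * of_real (ln (z\<^sup>2) + k * b)) = exp (of_real (c * k * ?l)) *
        (Gamma (Complex ?a (0 + (- k) * t)) * iexp (- ((0 + (- k) * t) * ?l)))"
      by (simp only: exp_add mult_ac)
  qed
  \<comment> \<open>The substitution of \<open>- k * t\<close> for \<open>t\<close> has Jacobian 1
    in modulus.\<close>
  also have "\<dots> = exp (of_real (c * k * ?l)) *
      (LINT t|lborel. Gamma (Complex ?a t) * iexp (- (t * ?l)))"
    using assms(1) lborel_integral_real_affine[of "- k" "\<lambda>t. Gamma (Complex ?a t) * iexp (- (t * ?l))" 0]
    by (cases "k = 0") simp_all
  also have "\<dots> = exp (of_real (c * k * ?l)) * of_real (2 * pi * exp (?a * ?l - exp ?l))"
    using assms by (subst Gamma_line_inversion) auto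
  also have "\<dots> = of_real (2 * pi * (exp (c * k * ?l) * exp (?a * ?l - exp ?l)))"
    by (simp only: exp_of_real) (simp only: of_real_mult mult_ac)
  also have "exp (c * k * ?l) * exp (?a * ?l - exp ?l) = exp (?l / 2 - exp ?l)"
    unfolding exp_add[symmetric] by (rule arg_cong[of _ _ exp]) (simp add: algebra_simps)
  finally have I: "(LINT t|lborel. Gamma (1 / 2 - of_real k * Complex c t) *
       exp (Complex c t * of_real (ln (z\<^sup>2) + k * b))) = of_real (2 * pi * exp (?l / 2 - exp ?l))" .
  show ?thesis
    unfolding I of_real_mult[symmetric] of_real_eq_iff gauss_power_density_def
    using assms(3) by simp
qed

text \<open>One factor is integrable and the others are bounded by \<open>norm_Gamma_le\<close>. The
  induction starts at a singleton because the empty product 1 is not integrable.\<close>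

lemma integrable_mellin_kernel:
  assumes "finite K" "K \<noteq> {}" "\<And>j. j \<in> K \<Longrightarrow> \<bar>\<kappa> j\<bar> = 1" "\<And>j. j \<in> K \<Longrightarrow> \<kappa> j * c < 1 / 2"
  shows "integrable lborel (\<lambda>t. \<Prod>j\<in>K. Gamma (1 / 2 - of_real (\<kappa> j) * Complex c t))"
  using assms
proof (induction K rule: finite_ne_induct)
  case (singleton j)
  then show ?case
    using integrable_Gamma_mellin_line[of "\<kappa> j" c] by simp
next
  case (insert j K)
  let ?G = "\<lambda>t. Gamma (1 / 2 - of_real (\<kappa> j) * Complex c t)"
  let ?K = "\<lambda>t. \<Prod>j\<in>K. Gamma (1 / 2 - of_real (\<kappa> j) * Complex c t)"
  define B where "B = norm (Gamma (of_real (1 / 2 - \<kappa> j * c) :: complex))"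
  have int: "integrable lborel ?G" "integrable lborel ?K"
    using insert integrable_Gamma_mellin_line[of "\<kappa> j" c] by auto
  have B: "norm (?G t) \<le> B" for t
    using norm_Gamma_le[of "1 / 2 - of_real (\<kappa> j) * Complex c t"] insert.prems by (simp add: B_def)
  have "integrable lborel (\<lambda>t. ?G t * ?K t)"
  proof (rule Bochner_Integration.integrable_bound)
    show "integrable lborel (\<lambda>t. B *\<^sub>R ?K t)"
      using int by simp
    show "(\<lambda>t. ?G t * ?K t) \<in> borel_measurable lborel"
      using int by measurable
    show "AE t in lborel. norm (?G t * ?K t) \<le> norm (B *\<^sub>R ?K t)"
      using order_trans[OF B abs_ge_self] by (auto simp: norm_mult intro!: always_eventually mult_right_mono)
  qed
  then show ?case
    using insert by simp
qed

section \<open>Products and reciprocals of random variables\<close>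

text \<open>For fixed \<open>u \<noteq> 0\<close> substitute \<open>w = z / u\<close> in the joint
  density. Integrals in \<open>ennreal\<close> make Fubini free of integrability conditions and
  allow an infinite density on a null set.\<close>

lemma (in prob_space) distributed_mult_indep:
  fixes U W :: "'a \<Rightarrow> real" and f g :: "real \<Rightarrow> ennreal"
  assumes U: "distributed M lborel U f" and W: "distributed M lborel W g"
    and indep: "indep_var borel U borel W"
  shows "distributed M lborel (\<lambda>\<omega>. U \<omega> * W \<omega>) (\<lambda>z. \<integral>\<^sup>+u. f u * g (z / u) * ennreal (1 / \<bar>u\<bar>) \<partial>lborel)"
proof -
  have [measurable]: "f \<in> borel_measurable borel" "g \<in> borel_measurable borel"
      "U \<in> borel_measurable M" "W \<in> borel_measurable M"
    using U W by (auto simp: distributed_def)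
  have "indep_var lborel U lborel W"
    using indep unfolding indep_var_eq by simp
  then have joint: "distributed M (lborel \<Otimes>\<^sub>M lborel) (\<lambda>x. (U x, W x)) (\<lambda>(u, w). f u * g w)"
    by (intro distributed_joint_indep U W lborel.sigma_finite_measure_axioms)
  let ?h = "\<lambda>z. \<integral>\<^sup>+u. f u * g (z / u) * ennreal (1 / \<bar>u\<bar>) \<partial>lborel"
  have [measurable]: "?h \<in> borel_measurable borel"
    by measurable
  have "distr M lborel (\<lambda>\<omega>. U \<omega> * W \<omega>) = density lborel ?h"
  proof (rule measure_eqI)
    fix A assume "A \<in> sets (distr M lborel (\<lambda>\<omega>. U \<omega> * W \<omega>))"
    then have [measurable]: "A \<in> sets borel" by simp
    have "emeasure (distr M lborel (\<lambda>\<omega>. U \<omega> * W \<omega>)) A = (\<integral>\<^sup>+\<omega>. indicator A (U \<omega> * W \<omega>) \<partial>M)"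
      by (subst nn_integral_indicator[symmetric], simp, subst nn_integral_distr) auto
    also have "\<dots> = (\<integral>\<^sup>+(u, w). f u * g w * indicator A (u * w) \<partial>(lborel \<Otimes>\<^sub>M lborel))"
      using distributed_nn_integral[OF joint, of "\<lambda>(u, w). indicator A (u * w)"]
      by (simp add: case_prod_beta')
    also have "\<dots> = (\<integral>\<^sup>+u. \<integral>\<^sup>+w. f u * g w * indicator A (u * w) \<partial>lborel \<partial>lborel)"
      by (subst lborel.nn_integral_fst[symmetric]) (auto simp: case_prod_beta')
    also have "\<dots> = (\<integral>\<^sup>+u. \<integral>\<^sup>+z. f u * g (z / u) * ennreal (1 / \<bar>u\<bar>) * indicator A z \<partial>lborel \<partial>lborel)"
    proof (rule nn_integral_cong_AE)
      have "AE u in lborel. u \<noteq> (0::real)"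
        by (rule AE_lborel_singleton)
      then show "AE u in lborel. (\<integral>\<^sup>+w. f u * g w * indicator A (u * w) \<partial>lborel) =
          (\<integral>\<^sup>+z. f u * g (z / u) * ennreal (1 / \<bar>u\<bar>) * indicator A z \<partial>lborel)"
      proof eventually_elim
        case (elim u)
        then show ?case
          by (subst nn_integral_real_affine[of _ "1 / u" 0])
             (auto simp: nn_integral_cmult[symmetric] mult_ac)
      qed
    qed
    also have "\<dots> = (\<integral>\<^sup>+z. \<integral>\<^sup>+u. f u * g (z / u) * ennreal (1 / \<bar>u\<bar>) * indicator A z \<partial>lborel \<partial>lborel)"
      by (rule lborel_pair.Fubini') measurable
    also have "\<dots> = emeasure (density lborel ?h) A"
      by (simp add: emeasure_density nn_integral_multc)
    finally show "emeasure (distr M lborel (\<lambda>\<omega>. U \<omega> * W \<omega>)) A = emeasure (density lborel ?h) A" .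
  qed simp
  then show ?thesis
    by (simp add: distributed_def)
qed

lemma (in prob_space) distributed_inverse:
  fixes Y :: "'a \<Rightarrow> real" and f :: "real \<Rightarrow> real"
  assumes Y: "distributed M lborel Y (\<lambda>y. ennreal (f y))"
    and f: "integrable lborel f" "\<And>y. f y \<ge> 0"
  shows "distributed M lborel (\<lambda>\<omega>. 1 / Y \<omega>) (\<lambda>u. ennreal (f (1 / u) / u\<^sup>2))"
proof -
  have [measurable]: "f \<in> borel_measurable borel" "Y \<in> borel_measurable M"
    using f Y by (auto simp: distributed_def)
  let ?h = "\<lambda>u. f (1 / u) / u\<^sup>2"
  have "distr M lborel (\<lambda>\<omega>. 1 / Y \<omega>) = density lborel ?h"
  proof (rule measure_eqI)
    fix A assume "A \<in> sets (distr M lborel (\<lambda>\<omega>. 1 / Y \<omega>))"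
    then have [measurable]: "A \<in> sets borel" by simp
    define F where "F y = f y * indicator A (1 / y)" for y
    have [measurable]: "F \<in> borel_measurable borel"
      unfolding F_def by measurable
    have F: "F y \<ge> 0" for y
      using f by (simp add: F_def)
    have Fint: "set_integrable lborel (- {0}) F"
      unfolding set_integrable_def
      by (rule Bochner_Integration.integrable_bound[OF f(1)])
         (auto simp: F_def indicator_def f(2))
    have im: "(\<lambda>u. 1 / u) ` (- {0}) = - {0::real}"
    proof -
      have "y \<in> (\<lambda>u. 1 / u) ` (- {0})" if "y \<noteq> 0" for y :: real
        using that by (intro image_eqI[of _ _ "1 / y"]) auto
      then show ?thesis by auto
    qed
    have der: "((\<lambda>u. 1 / u) has_field_derivative (- 1 / u\<^sup>2)) (at u)" if "u \<in> - {0}" for u :: real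
      using that by (auto intro!: derivative_eq_intros simp: power2_eq_square)
    have inj: "inj_on (\<lambda>u::real. 1 / u) (- {0})"
      by (auto simp: inj_on_def)
    note cov = lborel_change_of_variables[of "- {0}" "\<lambda>u. 1 / u" F "\<lambda>u. - 1 / u\<^sup>2", unfolded im,
        OF _ _ _ _ _ der inj]
    \<comment> \<open>At \<open>u = 0\<close> both sides vanish, the right one through division by
      \<open>0^2\<close>.\<close>
    have eq: "indicator (- {0}) u *\<^sub>R \<bar>- 1 / u\<^sup>2\<bar> *\<^sub>R F (1 / u) = ?h u * indicator A u" for u
      by (cases "u = 0") (auto simp: F_def)
    have hint: "integrable lborel (\<lambda>u. ?h u * indicator A u)"
      using cov(1) Fint unfolding set_integrable_def eq by simp
    have hval: "(LINT u|lborel. ?h u * indicator A u) = (LINT y:- {0}|lborel. F y)"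
      using cov(2) unfolding set_lebesgue_integral_def eq by simp
    have "emeasure (distr M lborel (\<lambda>\<omega>. 1 / Y \<omega>)) A = (\<integral>\<^sup>+\<omega>. indicator A (1 / Y \<omega>) \<partial>M)"
      by (subst nn_integral_indicator[symmetric], simp, subst nn_integral_distr) auto
    also have "\<dots> = (\<integral>\<^sup>+y. ennreal (f y) * indicator A (1 / y) \<partial>lborel)"
      using distributed_nn_integral[OF Y, of "\<lambda>y. indicator A (1 / y)"] by simp
    also have "\<dots> = (\<integral>\<^sup>+y. ennreal (indicator (- {0}) y *\<^sub>R F y) \<partial>lborel)"
    proof (rule nn_integral_cong_AE)
      have "AE u in lborel. u \<noteq> (0::real)"
        by (rule AE_lborel_singleton)
      then show "AE y in lborel. ennreal (f y) * indicator A (1 / y) =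
          ennreal (indicator (- {0}) y *\<^sub>R F y)"
        by eventually_elim (auto simp: F_def indicator_def)
    qed
    also have "\<dots> = ennreal (LINT y:- {0}|lborel. F y)"
      unfolding set_lebesgue_integral_def
      using Fint F by (intro nn_integral_eq_integral) (auto simp: set_integrable_def)
    also have "\<dots> = (\<integral>\<^sup>+u. ennreal (?h u * indicator A u) \<partial>lborel)"
      unfolding hval[symmetric] using hint f by (intro nn_integral_eq_integral[symmetric]) auto
    also have "\<dots> = emeasure (density lborel ?h) A"
      by (subst emeasure_density) (auto intro!: nn_integral_cong simp: indicator_def)
    finally show "emeasure (distr M lborel (\<lambda>\<omega>. 1 / Y \<omega>)) A = emeasure (density lborel ?h) A" .
  qed simp
  then show ?thesis
    by (simp add: distributed_def)
qed

section \<open>Mellin representation of products\<close>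

text \<open>The integration variable is \<open>p = s + 1 / 2\<close>, so that \<open>\<Gamma>(- s) = \<Gamma>(1 / 2 - p)\<close> belongs to a
  normal factor (\<open>\<kappa> = 1\<close>) and \<open>\<Gamma>(1 + s) = \<Gamma>(1 / 2 + p)\<close> to an inverse normal one (\<open>\<kappa> = - 1\<close>).\<close>

definition mellin_line :: "('i \<Rightarrow> real) \<Rightarrow> ('i \<Rightarrow> real) \<Rightarrow> 'i set \<Rightarrow> real \<Rightarrow> real \<Rightarrow> complex" where
  "mellin_line \<kappa> b K c z = (LINT t|lborel.
     (\<Prod>j\<in>K. Gamma (1 / 2 - of_real (\<kappa> j) * Complex c t)) *
       exp (Complex c t * of_real (ln (z\<^sup>2) + (\<Sum>j\<in>K. \<kappa> j * b j))))"

lemma measurable_Complex [measurable]: "(\<lambda>t. Complex c t) \<in> borel_measurable borel"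
  unfolding Complex_eq by measurable

text \<open>Under the Mellin transform multiplicative convolution becomes a product: after Fubini
  the \<open>u\<close>-integral is the moment of \<open>d\<close> at \<open>p = Complex c t\<close>,
  which supplies the Gamma factor of \<open>j\<close> and the shift
  \<open>\<kappa> j * b j\<close>.\<close>

lemma mellin_line_convolution:
  fixes f :: "real \<Rightarrow> real" and C :: real
  assumes K: "finite K" "K \<noteq> {}" "j \<notin> K" and \<kappa>: "\<And>i. i \<in> insert j K \<Longrightarrow> \<bar>\<kappa> i\<bar> = 1"
    and c: "\<And>i. i \<in> insert j K \<Longrightarrow> \<kappa> i * c < 1 / 2"
    and f: "\<And>z. z \<noteq> 0 \<Longrightarrow> of_real (\<bar>z\<bar> * f z) = of_real C * mellin_line \<kappa> b K c z"
    and z: "z \<noteq> 0"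
  defines "d \<equiv> gauss_power_density (\<kappa> j) (b j)"
  shows "integrable lborel (\<lambda>u. f (z / u) * d u / \<bar>u\<bar>)"
    and "of_real (\<bar>z\<bar> * (LINT u|lborel. f (z / u) * d u / \<bar>u\<bar>)) =
      of_real (C / sqrt pi) * mellin_line \<kappa> b (insert j K) c z"
proof -
  define G where "G t = (\<Prod>j\<in>K. Gamma (1 / 2 - of_real (\<kappa> j) * Complex c t))" for t
  define B where "B = (\<Sum>j\<in>K. \<kappa> j * b j)"
  define E where "E t = exp (Complex c t * of_real (ln (z\<^sup>2) + B))" for t
  define m where "m p u = d u *\<^sub>R exp (- (p * of_real (ln (u\<^sup>2))))" for p :: complex and u
  define H where "H t u = G t * E t * m (Complex c t) u" for t u
  have d: "d u \<ge> 0" "d 0 = 0" for u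
    by (simp_all add: d_def gauss_power_density_nonneg)
  have Gint: "integrable lborel G"
    unfolding G_def using assms by (intro integrable_mellin_kernel) auto
  have [measurable]: "G \<in> borel_measurable borel" "E \<in> borel_measurable borel"
      "d \<in> borel_measurable borel"
    using Gint unfolding E_def d_def by measurable
  have mint: "integrable lborel (m p)"
    and mval: "(LINT u|lborel. m p u) =
      of_real (1 / sqrt pi) * Gamma (1 / 2 - of_real (\<kappa> j) * p) * exp (p * of_real (\<kappa> j * b j))"
    if "Re p = c" for p
    using gauss_power_density_moment[of "\<kappa> j" p "b j"] that c \<kappa>
    by (simp_all add: m_def[abs_def] d_def)
  have mnorm: "norm (m (Complex c t) u) = d u * exp (- (c * ln (u\<^sup>2)))" for t u
    using d by (simp add: m_def)
  have mnorm': "integrable lborel (\<lambda>u. d u * exp (- (c * ln (u\<^sup>2))))"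
    using integrable_norm[OF mint[of "Complex c 0"]] by (simp add: mnorm)
  have Enorm: "norm (E t) = exp (c * (ln (z\<^sup>2) + B))" for t
    by (simp add: E_def)
  \<comment> \<open>The modulus of \<open>H\<close> is a constant times a function of
    \<open>t\<close> times a function of \<open>u\<close>, both integrable, because
    \<open>norm (m p u)\<close> depends on \<open>p\<close> only through
    \<open>Re p = c\<close>.\<close>
  have Hint: "integrable (lborel \<Otimes>\<^sub>M lborel) (case_prod H)"
  proof (rule lborel_pair.Fubini_integrable)
    show "case_prod H \<in> borel_measurable (lborel \<Otimes>\<^sub>M lborel)"
      unfolding H_def m_def by measurable
    show "integrable lborel (\<lambda>t. LINT u|lborel. norm (case (t, u) of (t, u) \<Rightarrow> H t u))"
      using Gint by (simp add: H_def norm_mult mnorm Enorm)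
    show "AE t in lborel. integrable lborel (\<lambda>u. case (t, u) of (t, u) \<Rightarrow> H t u)"
      by (auto simp: H_def intro!: always_eventually mint)
  qed
  \<comment> \<open>The left-hand side is \<open>\<bar>z / u\<bar> * f (z / u) * d u\<close>, so the
    representation of \<open>f\<close> applies at \<open>z / u\<close>; for \<open>u = 0\<close>
    both sides are 0.\<close>
  have eq: "of_real (\<bar>z\<bar> * (f (z / u) * d u / \<bar>u\<bar>)) = of_real C * (LINT t|lborel. H t u)" for u
  proof (cases "u = 0")
    case True
    then show ?thesis by (simp add: H_def m_def d)
  next
    case False
    have "of_real (\<bar>z\<bar> * (f (z / u) * d u / \<bar>u\<bar>)) = of_real (\<bar>z / u\<bar> * f (z / u)) * of_real (d u)"
      by (simp only: abs_divide flip: of_real_mult) (simp add: mult_ac)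
    also have "\<dots> = of_real C * (mellin_line \<kappa> b K c (z / u) * of_real (d u))"
      using f[of "z / u"] False z by simp
    also have "mellin_line \<kappa> b K c (z / u) * of_real (d u) = (LINT t|lborel. H t u)"
      unfolding mellin_line_def integral_mult_left_zero[symmetric]
    proof (rule Bochner_Integration.integral_cong[OF refl])
      fix t
      have "Complex c t * of_real (ln ((z / u)\<^sup>2) + B) =
          Complex c t * of_real (ln (z\<^sup>2) + B) + - (Complex c t * of_real (ln (u\<^sup>2)))"
        using False z by (simp add: power_divide ln_div algebra_simps)
      then show "(\<Prod>j\<in>K. Gamma (1 / 2 - of_real (\<kappa> j) * Complex c t)) *
          exp (Complex c t * of_real (ln ((z / u)\<^sup>2) + (\<Sum>j\<in>K. \<kappa> j * b j))) * of_real (d u) = H t u"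
        by (simp only: H_def G_def E_def m_def B_def exp_add scaleR_conv_of_real mult_ac)
    qed
    finally show ?thesis .
  qed
  \<comment> \<open>Fubini also yields integrability of the inner integral in \<open>u\<close>,
    hence finiteness of the convolution at every \<open>z \<noteq> 0\<close>.\<close>
  have "integrable lborel (\<lambda>u. of_real C * (LINT t|lborel. H t u))"
    using lborel_pair.integrable_snd[OF Hint] by simp
  then have "integrable lborel (\<lambda>u. \<bar>z\<bar> * (f (z / u) * d u / \<bar>u\<bar>))"
    unfolding eq[symmetric] complex_of_real_integrable_eq .
  then have "integrable lborel (\<lambda>u. (1 / \<bar>z\<bar>) * (\<bar>z\<bar> * (f (z / u) * d u / \<bar>u\<bar>)))"
    by (rule integrable_mult_right)
  then show "integrable lborel (\<lambda>u. f (z / u) * d u / \<bar>u\<bar>)"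
    using z by (simp only: mult.assoc[symmetric]) simp
  have "of_real (\<bar>z\<bar> * (LINT u|lborel. f (z / u) * d u / \<bar>u\<bar>)) =
      (LINT u|lborel. complex_of_real (\<bar>z\<bar> * (f (z / u) * d u / \<bar>u\<bar>)))"
    by (simp only: integral_complex_of_real integral_mult_right_zero)
  also have "\<dots> = of_real C * (LINT u|lborel. LINT t|lborel. H t u)"
    unfolding eq by simp
  also have "(LINT u|lborel. LINT t|lborel. H t u) = (LINT t|lborel. LINT u|lborel. H t u)"
    by (rule lborel_pair.Fubini_integral[OF Hint])
  also have "\<dots> = (LINT t|lborel. of_real (1 / sqrt pi) *
      ((\<Prod>j\<in>insert j K. Gamma (1 / 2 - of_real (\<kappa> j) * Complex c t)) *
       exp (Complex c t * of_real (ln (z\<^sup>2) + (\<Sum>j\<in>insert j K. \<kappa> j * b j)))))"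
  proof (rule Bochner_Integration.integral_cong[OF refl])
    fix t
    have "(LINT u|lborel. H t u) = G t * E t * (of_real (1 / sqrt pi) *
        Gamma (1 / 2 - of_real (\<kappa> j) * Complex c t) * exp (Complex c t * of_real (\<kappa> j * b j)))"
      unfolding H_def integral_mult_right_zero by (subst mval) simp_all
    moreover have "exp (Complex c t * of_real (ln (z\<^sup>2) + (\<Sum>j\<in>insert j K. \<kappa> j * b j))) =
        E t * exp (Complex c t * of_real (\<kappa> j * b j))"
      using K by (simp add: E_def B_def algebra_simps flip: exp_add)
    ultimately show "(LINT u|lborel. H t u) = of_real (1 / sqrt pi) *
      ((\<Prod>j\<in>insert j K. Gamma (1 / 2 - of_real (\<kappa> j) * Complex c t)) *
       exp (Complex c t * of_real (ln (z\<^sup>2) + (\<Sum>j\<in>insert j K. \<kappa> j * b j))))"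
      by (simp only: prod.insert[OF K(1,3)] G_def mult_ac)
  qed
  also have "\<dots> = of_real (1 / sqrt pi) * mellin_line \<kappa> b (insert j K) c z"
    unfolding mellin_line_def by (rule integral_mult_right_zero)
  finally show "of_real (\<bar>z\<bar> * (LINT u|lborel. f (z / u) * d u / \<bar>u\<bar>)) =
      of_real (C / sqrt pi) * mellin_line \<kappa> b (insert j K) c z"
    by simp
qed

text \<open>On the line the exponential has constant modulus, so the bound is a constant times
  \<open>\<bar>z\<bar>\<close> to the power \<open>2 * c\<close> for
  \<open>z \<noteq> 0\<close>.\<close>

lemma norm_mellin_line_le:
  "norm (mellin_line \<kappa> b K c z) \<le>
    (LINT t|lborel. norm (\<Prod>j\<in>K. Gamma (1 / 2 - of_real (\<kappa> j) * Complex c t))) *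
      exp (c * (ln (z\<^sup>2) + (\<Sum>j\<in>K. \<kappa> j * b j)))"
  unfolding mellin_line_def integral_mult_left_zero[symmetric]
  by (rule order_trans[OF integral_norm_bound]) (simp add: norm_mult)

text \<open>With a normal factor \<open>i\<close> as the start of the induction, every multiplicative convolution
  stays decreasing in the modulus; this is what gives the limit at \<open>0\<close>.\<close>

lemma (in prob_space) distributed_prod_gauss_power:
  fixes U :: "'i \<Rightarrow> 'a \<Rightarrow> real"
  assumes K: "finite K" "i \<notin> K"
    and \<kappa>: "\<And>j. j \<in> insert i K \<Longrightarrow> \<bar>\<kappa> j\<bar> = 1"
    and indep: "indep_vars (\<lambda>_. borel) U (insert i K)"
    and U: "\<And>j. j \<in> insert i K \<Longrightarrow>
      distributed M lborel (U j) (\<lambda>u. ennreal (gauss_power_density (\<kappa> j) (b j) u))"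
  shows "\<exists>f. (\<forall>z. f z \<ge> 0) \<and> f \<in> borel_measurable borel \<and>
    distributed M lborel (\<lambda>\<omega>. \<Prod>j\<in>insert i K. U j \<omega>) (\<lambda>z. ennreal (f z)) \<and>
    (\<forall>z c. z \<noteq> 0 \<longrightarrow> (\<forall>j\<in>insert i K. \<kappa> j * c < 1 / 2) \<longrightarrow>
      of_real (\<bar>z\<bar> * f z) =
        of_real (1 / (sqrt pi ^ card (insert i K) * (2 * pi))) * mellin_line \<kappa> b (insert i K) c z) \<and>
    (\<forall>y z. \<kappa> i = 1 \<longrightarrow> y \<noteq> 0 \<longrightarrow> \<bar>y\<bar> \<le> \<bar>z\<bar> \<longrightarrow> f z \<le> f y)"
  using K \<kappa> indep U
proof (induction K rule: finite_induct)
  case empty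
  have "complex_of_real (\<bar>z\<bar> * gauss_power_density (\<kappa> i) (b i) z) =
      of_real (1 / (sqrt pi ^ card {i} * (2 * pi))) * mellin_line \<kappa> b {i} c z"
    if "z \<noteq> 0" "\<kappa> i * c < 1 / 2" for z c
    using gauss_power_density_inversion[of "\<kappa> i" c z "b i"] that empty by (simp add: mellin_line_def)
  then show ?case
    using empty gauss_power_density_nonneg gauss_power_density_antimono[of _ _ "b i"]
    by (intro exI[of _ "gauss_power_density (\<kappa> i) (b i)"]) auto
next
  case (insert j K)
  let ?K = "insert i K"
  let ?d = "gauss_power_density (\<kappa> j) (b j)"
  have ne: "insert i (insert j K) = insert j ?K" and j: "j \<notin> ?K"
    using insert by auto
  note \<kappa> = insert.prems(2)[unfolded ne]
  have "indep_vars (\<lambda>_. borel) U ?K"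
    using insert.prems(3) by (rule indep_vars_subset) auto
  then have IH: "\<exists>f. (\<forall>z. f z \<ge> 0) \<and> f \<in> borel_measurable borel \<and>
      distributed M lborel (\<lambda>\<omega>. \<Prod>j\<in>?K. U j \<omega>) (\<lambda>z. ennreal (f z)) \<and>
      (\<forall>z c. z \<noteq> 0 \<longrightarrow> (\<forall>j\<in>?K. \<kappa> j * c < 1 / 2) \<longrightarrow> of_real (\<bar>z\<bar> * f z) =
        of_real (1 / (sqrt pi ^ card ?K * (2 * pi))) * mellin_line \<kappa> b ?K c z) \<and>
      (\<forall>y z. \<kappa> i = 1 \<longrightarrow> y \<noteq> 0 \<longrightarrow> \<bar>y\<bar> \<le> \<bar>z\<bar> \<longrightarrow> f z \<le> f y)"
    by (intro insert.IH) (use insert.prems in auto)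
  then obtain f where f: "\<And>z. f z \<ge> 0" and [measurable]: "f \<in> borel_measurable borel"
    and dist: "distributed M lborel (\<lambda>\<omega>. \<Prod>j\<in>?K. U j \<omega>) (\<lambda>z. ennreal (f z))"
    and rep: "\<And>z c. z \<noteq> 0 \<Longrightarrow> (\<forall>j\<in>?K. \<kappa> j * c < 1 / 2) \<Longrightarrow> of_real (\<bar>z\<bar> * f z) =
        of_real (1 / (sqrt pi ^ card ?K * (2 * pi))) * mellin_line \<kappa> b ?K c z"
    and mono: "\<And>y z. \<kappa> i = 1 \<Longrightarrow> y \<noteq> 0 \<Longrightarrow> \<bar>y\<bar> \<le> \<bar>z\<bar> \<Longrightarrow> f z \<le> f y"
    by blast
  define f' where "f' z = (LINT u|lborel. f (z / u) * ?d u / \<bar>u\<bar>)" for z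
  \<comment> \<open>The line \<open>c = 0\<close> is admissible for factors of either kind, so it
    gives integrability in all cases.\<close>
  have int: "integrable lborel (\<lambda>u. f (z / u) * ?d u / \<bar>u\<bar>)" if "z \<noteq> 0" for z
    by (rule mellin_line_convolution(1)[of ?K j \<kappa> 0 f "1 / (sqrt pi ^ card ?K * (2 * pi))"])
       (use insert j \<kappa> rep that in auto)
  have d: "?d u \<ge> 0" for u
    by (rule gauss_power_density_nonneg)
  have f': "f' z \<ge> 0" for z
    unfolding f'_def using f d by (intro integral_nonneg_AE always_eventually) auto
  have [measurable]: "f' \<in> borel_measurable borel"
    unfolding f'_def by measurable
  have rep': "complex_of_real (\<bar>z\<bar> * f' z) = of_real (1 / (sqrt pi ^ card (insert j ?K) * (2 * pi))) *
      mellin_line \<kappa> b (insert j ?K) c z"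
    if "z \<noteq> 0" "\<forall>j\<in>insert j ?K. \<kappa> j * c < 1 / 2" for z c
  proof -
    have "complex_of_real (\<bar>z\<bar> * f' z) =
        of_real (1 / (sqrt pi ^ card ?K * (2 * pi)) / sqrt pi) * mellin_line \<kappa> b (insert j ?K) c z"
      unfolding f'_def
      by (rule mellin_line_convolution(2)) (use insert j \<kappa> rep that in auto)
    moreover have "1 / (sqrt pi ^ card ?K * (2 * pi)) / sqrt pi =
        1 / (sqrt pi ^ card (insert j ?K) * (2 * pi))"
      using insert j by simp
    ultimately show ?thesis by (simp only:)
  qed
  \<comment> \<open>The inequality passes through the convolution pointwise, since
    \<open>\<bar>y / u\<bar> \<le> \<bar>z / u\<bar>\<close>; at \<open>u = 0\<close> both
    integrands are 0.\<close>
  have mono': "f' z \<le> f' y" if "\<kappa> i = 1" "y \<noteq> 0" "\<bar>y\<bar> \<le> \<bar>z\<bar>" for y z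
    unfolding f'_def
  proof (intro integral_mono int)
    show "f (z / u) * ?d u / \<bar>u\<bar> \<le> f (y / u) * ?d u / \<bar>u\<bar>" for u
      by (cases "u = 0") (use that d in \<open>auto intro!: divide_right_mono mult_right_mono mono\<close>)
  qed (use that in auto)
  have "indep_var borel (U j) borel (\<lambda>\<omega>. \<Prod>j\<in>?K. U j \<omega>)"
    using insert.prems(3)[unfolded ne] insert.hyps j by (intro indep_vars_prod) auto
  from distributed_mult_indep[OF _ dist this] insert.prems(4)[of j]
  have "distributed M lborel (\<lambda>\<omega>. U j \<omega> * (\<Prod>j\<in>?K. U j \<omega>))
      (\<lambda>z. \<integral>\<^sup>+u. ennreal (?d u) * ennreal (f (z / u)) * ennreal (1 / \<bar>u\<bar>) \<partial>lborel)"
    by auto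
  \<comment> \<open>Off the origin the \<open>ennreal\<close> convolution is finite and agrees with
    the Bochner integral \<open>f'\<close>.\<close>
  moreover have "AE z in lborel. (\<integral>\<^sup>+u. ennreal (?d u) * ennreal (f (z / u)) * ennreal (1 / \<bar>u\<bar>) \<partial>lborel) =
      ennreal (f' z)"
    using AE_lborel_singleton[of 0]
  proof eventually_elim
    case (elim z)
    have "(\<integral>\<^sup>+u. ennreal (?d u) * ennreal (f (z / u)) * ennreal (1 / \<bar>u\<bar>) \<partial>lborel) =
        (\<integral>\<^sup>+u. ennreal (f (z / u) * ?d u / \<bar>u\<bar>) \<partial>lborel)"
      using f d by (intro nn_integral_cong) (simp add: mult.commute flip: ennreal_mult)
    also have "\<dots> = ennreal (f' z)"
      unfolding f'_def using int elim f d by (intro nn_integral_eq_integral) auto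
    finally show ?case .
  qed
  ultimately have "distributed M lborel (\<lambda>\<omega>. U j \<omega> * (\<Prod>j\<in>?K. U j \<omega>)) (\<lambda>z. ennreal (f' z))"
    by (subst (asm) distributed_cong_density) auto
  moreover have "(\<Prod>j\<in>insert j ?K. U j \<omega>) = U j \<omega> * (\<Prod>j\<in>?K. U j \<omega>)" for \<omega>
    using insert.hyps(1) j by (intro prod.insert) auto
  ultimately have dist': "distributed M lborel (\<lambda>\<omega>. \<Prod>j\<in>insert j ?K. U j \<omega>) (\<lambda>z. ennreal (f' z))"
    by (simp only:)
  show ?case
    unfolding ne
  proof (intro exI[of _ f'] conjI allI impI)
    show "f' z \<ge> 0" for z
      by (rule f')
    show "f' \<in> borel_measurable borel"
      by measurable
  qed (fact dist' rep' mono')+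
qed

section \<open>The Meijer G-function\<close>

text \<open>The poles nearest the strip are \<open>s = 0\<close> of \<open>Gamma (- s)\<close> and
  \<open>s = - 1\<close> of \<open>Gamma (1 + s)\<close>. If \<open>M = 0\<close> or
  \<open>N = 0\<close>, the line is unrestricted on the corresponding side.\<close>

lemma meijer_separating_replicate_0:
  assumes "meijer_separating M N (replicate N 0) (replicate M 0) c"
  shows "M > 0 \<Longrightarrow> c < 0" and "N > 0 \<Longrightarrow> - 1 < c"
proof -
  show "c < 0" if "M > 0"
    using assms that unfolding meijer_separating_def by (auto dest!: spec[of _ 0])
  show "- 1 < c" if "N > 0"
  proof -
    have "1 - replicate N 0 ! 0 + (- 1 :: complex) \<in> \<int>\<^sub>\<le>\<^sub>0"
      using that by simp
    then have "Re (- 1) < c"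
      using assms that unfolding meijer_separating_def by blast
    then show ?thesis by simp
  qed
qed

text \<open>Without a separating line the description in \<open>meijer_G\<close> would hold for
  every value; this line serves all \<open>M\<close> and \<open>N\<close>.\<close>

lemma meijer_separating_minus_half:
  "meijer_separating M N (replicate N 0) (replicate M 0) (- 1 / 2)"
  unfolding meijer_separating_def
  by (auto elim!: nonpos_Ints_cases simp: complex_eq_iff)

text \<open>The factor \<open>\<i>\<close> is \<open>ds / dt\<close> on the line
  \<open>s = c + \<i> * t\<close>; truncation is removed by dominated convergence.\<close>

lemma tendsto_line_integral:
  fixes f :: "complex \<Rightarrow> complex"
  assumes "integrable lborel (\<lambda>t. f (Complex c t))"
  shows "((\<lambda>T. contour_integral (linepath (Complex c (- T)) (Complex c T)) f)
    \<longlongrightarrow> \<i> * (LINT t|lborel. f (Complex c t))) at_top"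
proof -
  let ?f = "\<lambda>t. f (Complex c t)"
  have [measurable]: "?f \<in> borel_measurable borel"
    using assms by auto
  have "((\<lambda>T. LINT t|lborel. indicator {- T..T} t *\<^sub>R ?f t) \<longlongrightarrow> (LINT t|lborel. ?f t)) at_top"
  proof (rule integral_dominated_convergence_at_top)
    show "integrable lborel (\<lambda>t. norm (?f t))"
      using assms by simp
    have "eventually (\<lambda>T. indicator {- T..T} t *\<^sub>R ?f t = ?f t) at_top" for t
      using eventually_ge_at_top[of "\<bar>t\<bar>"] by eventually_elim (auto simp: indicator_def)
    then show "AE t in lborel. ((\<lambda>T. indicator {- T..T} t *\<^sub>R ?f t) \<longlongrightarrow> ?f t) at_top"
      by (intro AE_I2 tendsto_eventually)
    show "\<forall>\<^sub>F T in at_top. AE t in lborel. norm (indicator {- T..T} t *\<^sub>R ?f t) \<le> norm (?f t)"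
      by (intro always_eventually allI) (auto simp: indicator_def)
  qed measurable
  then have "((\<lambda>T. \<i> * (LINT t|lborel. indicator {- T..T} t *\<^sub>R ?f t)) \<longlongrightarrow>
      \<i> * (LINT t|lborel. ?f t)) at_top"
    by (intro tendsto_intros)
  moreover have "\<forall>\<^sub>F T in at_top. \<i> * (LINT t|lborel. indicator {- T..T} t *\<^sub>R ?f t) =
      contour_integral (linepath (Complex c (- T)) (Complex c T)) f"
    using eventually_gt_at_top[of 0]
  proof eventually_elim
    case (elim T)
    have "set_integrable lborel {- T..T} ?f"
      unfolding set_integrable_def by (rule integrable_mult_indicator) (use assms in auto)
    then show ?case
      using elim set_borel_integral_eq_integral(2)[of "{- T..T}" ?f]
      by (subst contour_integral_linepath_same_Re[of _ c _ "- T" T])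
         (auto simp: set_lebesgue_integral_def)
  qed
  ultimately show ?thesis
    by (rule Lim_transform_eventually)
qed

text \<open>To evaluate \<open>THE\<close> the integral must equal the same \<open>v\<close> on
  every separating line, which is why the assumption ranges over all such \<open>c\<close>.\<close>

lemma meijer_G_replicate_0:
  fixes x :: real and v :: complex and M N :: nat
  defines "F \<equiv> \<lambda>s. Gamma (- s) ^ M * Gamma (1 + s) ^ N * exp (s * of_real (ln x))"
  assumes x: "x > 0"
    and F: "\<And>c. (M > 0 \<Longrightarrow> c < 0) \<Longrightarrow> (N > 0 \<Longrightarrow> - 1 < c) \<Longrightarrow>
      integrable lborel (\<lambda>t. F (Complex c t)) \<and> (LINT t|lborel. F (Complex c t)) = of_real (2 * pi) * v"
  shows "meijer_G M N (replicate N 0) (replicate M 0) (of_real x) = v"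
proof -
  let ?L = "\<lambda>v c. ((\<lambda>T. 1 / (2 * of_real pi * \<i>) *
      contour_integral (linepath (Complex c (- T)) (Complex c T))
        (meijer_integrand M N (replicate N 0) (replicate M 0) (of_real x))) \<longlongrightarrow> v) at_top"
  let ?sep = "meijer_separating M N (replicate N 0) (replicate M 0)"
  \<comment> \<open>The denominator products are empty, and \<open>x > 0\<close> turns
    \<open>x powr s\<close> into \<open>exp (s * ln x)\<close>.\<close>
  have F_eq: "meijer_integrand M N (replicate N 0) (replicate M 0) (of_real x) = F"
    using x by (auto simp: fun_eq_iff meijer_integrand_def F_def powr_def Ln_of_real)
  have L: "?L v c" if "?sep c" for c
  proof -
    have *: "integrable lborel (\<lambda>t. F (Complex c t))"
        "(LINT t|lborel. F (Complex c t)) = of_real (2 * pi) * v"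
      using F[of c] meijer_separating_replicate_0[OF that] by auto
    have "((\<lambda>T. 1 / (2 * of_real pi * \<i>) *
        contour_integral (linepath (Complex c (- T)) (Complex c T)) F)
        \<longlongrightarrow> 1 / (2 * of_real pi * \<i>) * (\<i> * (of_real (2 * pi) * v))) at_top"
      unfolding *(2)[symmetric] by (intro tendsto_intros tendsto_line_integral *(1))
    then show ?thesis
      by (simp add: F_eq)
  qed
  show ?thesis
    unfolding meijer_G_def
  proof (rule the_equality)
    show "\<forall>c. ?sep c \<longrightarrow> ?L v c"
      using L by blast
    show "w = v" if w: "\<forall>c. ?sep c \<longrightarrow> ?L w c" for w
    proof (rule tendsto_unique[OF trivial_limit_at_top_linorder])
      show "?L w (- 1 / 2)"
        using w meijer_separating_minus_half[of M N] by (simp only:)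
      show "?L v (- 1 / 2)"
        using L[OF meijer_separating_minus_half] .
    qed
  qed
qed

section \<open>The limit at 0 and the density of the quotient\<close>

text \<open>A function decreasing in the modulus tends to its supremum; in \<open>ennreal\<close>
  this supremum always exists, possibly infinite.\<close>

lemma tendsto_SUP_at_0:
  fixes f :: "real \<Rightarrow> ennreal"
  assumes "\<And>y z. y \<noteq> 0 \<Longrightarrow> \<bar>y\<bar> \<le> \<bar>z\<bar> \<Longrightarrow> f z \<le> f y"
  shows "(f \<longlongrightarrow> (SUP z\<in>- {0}. f z)) (at 0)"
proof (rule order_tendstoI)
  fix a assume "a < (SUP z\<in>- {0}. f z)"
  then obtain y where y: "y \<noteq> 0" "a < f y"
    by (auto simp: less_SUP_iff)
  have "a < f z" if "z \<noteq> 0" "dist z 0 < \<bar>y\<bar>" for z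
    using y assms[of z y] that by (auto intro: order.strict_trans2)
  then show "eventually (\<lambda>z. a < f z) (at 0)"
    using y by (auto simp: eventually_at intro!: exI[of _ "\<bar>y\<bar>"])
next
  fix a assume a: "(SUP z\<in>- {0}. f z) < a"
  have "f z < a" if "z \<noteq> 0" for z
    by (rule order.strict_trans1[OF SUP_upper a]) (use that in simp)
  then show "eventually (\<lambda>z. f z < a) (at 0)"
    by (auto simp: eventually_at intro!: exI[of _ 1])
qed

text \<open>The density is \<open>ennreal\<close>-valued so that its value at 0 can be an infinite
  limit. Independence over the disjoint sum makes both families jointly independent.\<close>

theorem theorem2p1:
  fixes P :: "'a measure" and M N :: nat
    and X Y :: "nat \<Rightarrow> 'a \<Rightarrow> real" and \<sigma>X \<sigma>Y :: "nat \<Rightarrow> real"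
  assumes "prob_space P"
    and "M + N \<ge> 1"
    and "\<And>i. i \<in> {1..M} \<Longrightarrow> \<sigma>X i > 0"
    and "\<And>j. j \<in> {1..N} \<Longrightarrow> \<sigma>Y j > 0"
    and "prob_space.indep_vars P (\<lambda>_. borel) (case_sum X Y) ({1..M} <+> {1..N})"
    and "\<And>i. i \<in> {1..M} \<Longrightarrow> distributed P lborel (X i) (\<lambda>x. ennreal (normal_density 0 (\<sigma>X i) x))"
    and "\<And>j. j \<in> {1..N} \<Longrightarrow> distributed P lborel (Y j) (\<lambda>y. ennreal (normal_density 0 (\<sigma>Y j) y))"
  defines "\<sigma>M \<equiv> \<Prod>i=1..M. \<sigma>X i"
    and "sN \<equiv> \<Prod>j=1..N. \<sigma>Y j"
    and "Z \<equiv> \<lambda>\<omega>. (\<Prod>i=1..M. X i \<omega>) / (\<Prod>j=1..N. Y j \<omega>)"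
  shows "\<exists>fZ :: real \<Rightarrow> ennreal.
    distributed P lborel Z fZ \<and>
    (\<forall>z. z \<noteq> 0 \<longrightarrow> fZ z \<noteq> \<infinity> \<and>
       complex_of_real (enn2real (fZ z)) =
         complex_of_real (2 powr ((real N - real M) / 2) * sN
             / (pi powr ((real M + real N) / 2) * \<sigma>M)) *
         meijer_G M N (replicate N 0) (replicate M 0)
           (complex_of_real (2 ^ N * sN\<^sup>2 / (2 ^ M * \<sigma>M\<^sup>2) * z\<^sup>2))) \<and>
    (fZ \<longlongrightarrow> fZ 0) (at 0)"
proof -
  interpret prob_space P by fact
  define K :: "(nat + nat) set" where "K = {1..M} <+> {1..N}"
  define \<kappa> :: "nat + nat \<Rightarrow> real" where "\<kappa> = case_sum (\<lambda>_. 1) (\<lambda>_. - 1)"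
  define b where "b = case_sum (\<lambda>i. - ln (2 * (\<sigma>X i)\<^sup>2)) (\<lambda>j. - ln (2 * (\<sigma>Y j)\<^sup>2))"
  define U where "U = case_sum X (\<lambda>j \<omega>. 1 / Y j \<omega>)"
  have K: "finite K" "card K = M + N"
    by (simp_all add: K_def card_Plus)
  have \<kappa>: "\<bar>\<kappa> j\<bar> = 1" for j
    by (simp add: \<kappa>_def split: sum.split)
  have prod_K: "(\<Prod>j\<in>K. h j) = (\<Prod>i=1..M. h (Inl i)) * (\<Prod>j=1..N. h (Inr j))"
    for h :: "nat + nat \<Rightarrow> 'b::comm_monoid_mult"
    unfolding K_def by (subst prod.Plus) auto
  have sum_K: "(\<Sum>j\<in>K. h j) = (\<Sum>i=1..M. h (Inl i)) + (\<Sum>j=1..N. h (Inr j))"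
    for h :: "nat + nat \<Rightarrow> real"
    unfolding K_def by (subst sum.Plus) auto
  \<comment> \<open>Valid even where some \<open>Y j \<omega>\<close> is 0, since inversion commutes
    with products under \<open>1 / 0 = 0\<close>.\<close>
  have Z: "Z \<omega> = (\<Prod>j\<in>K. U j \<omega>)" for \<omega>
    by (simp add: prod_K U_def Z_def prod_dividef)
  have indep: "indep_vars (\<lambda>_. borel) U K"
  proof -
    have "indep_vars (\<lambda>_. borel) (\<lambda>j \<omega>. (case j of Inl _ \<Rightarrow> (\<lambda>x. x) | Inr _ \<Rightarrow> (\<lambda>y. 1 / y)) (case_sum X Y j \<omega>)) K"
      using assms(5) unfolding K_def by (rule indep_vars_compose2) (auto split: sum.split)
    also have "(\<lambda>j \<omega>. (case j of Inl _ \<Rightarrow> (\<lambda>x. x) | Inr _ \<Rightarrow> (\<lambda>y. 1 / y)) (case_sum X Y j \<omega>)) = U"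
      by (auto simp: U_def fun_eq_iff split: sum.split)
    finally show ?thesis .
  qed
  have nz: "AE u in lborel. u \<noteq> (0::real)"
    by (rule AE_lborel_singleton)
  have U: "distributed P lborel (U j) (\<lambda>u. ennreal (gauss_power_density (\<kappa> j) (b j) u))"
    if "j \<in> K" for j
  proof (cases j)
    case (Inl i)
    with that have i: "i \<in> {1..M}" by (auto simp: K_def)
    have "AE u in lborel. ennreal (normal_density 0 (\<sigma>X i) u) = ennreal (gauss_power_density (\<kappa> j) (b j) u)"
      using nz by eventually_elim (use assms(3)[OF i] in \<open>simp add: \<kappa>_def b_def Inl gauss_power_density_normal\<close>)
    then show ?thesis
      using assms(6)[OF i] by (subst distributed_cong_density[symmetric]) (auto simp: U_def Inl)
  next
    case (Inr i)
    with that have i: "i \<in> {1..N}" by (auto simp: K_def)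
    have "AE u in lborel. ennreal (normal_density 0 (\<sigma>Y i) (1 / u) / u\<^sup>2) = ennreal (gauss_power_density (\<kappa> j) (b j) u)"
      using nz by eventually_elim (use assms(4)[OF i] in \<open>simp add: \<kappa>_def b_def Inr gauss_power_density_inverse_normal\<close>)
    moreover have "distributed P lborel (\<lambda>\<omega>. 1 / Y i \<omega>) (\<lambda>u. ennreal (normal_density 0 (\<sigma>Y i) (1 / u) / u\<^sup>2))"
      using assms(4)[OF i] assms(7)[OF i] by (intro distributed_inverse) auto
    ultimately show ?thesis
      by (subst distributed_cong_density[symmetric]) (auto simp: U_def Inr)
  qed
  \<comment> \<open>start with a normal factor whenever there is one\<close>
  define i0 :: "nat + nat" where "i0 = (if M > 0 then Inl 1 else Inr 1)"
  have i0: "i0 \<in> K" "insert i0 (K - {i0}) = K" and \<kappa>0: "\<kappa> i0 = 1 \<longleftrightarrow> M > 0"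
    using assms(2) by (auto simp: i0_def K_def \<kappa>_def)
  obtain f where f: "\<And>z. f z \<ge> 0" and [measurable]: "f \<in> borel_measurable borel"
    and dist: "distributed P lborel Z (\<lambda>z. ennreal (f z))"
    and rep: "\<And>z c. z \<noteq> 0 \<Longrightarrow> (\<forall>j\<in>K. \<kappa> j * c < 1 / 2) \<Longrightarrow>
      of_real (\<bar>z\<bar> * f z) = of_real (1 / (sqrt pi ^ (M + N) * (2 * pi))) * mellin_line \<kappa> b K c z"
    and mono: "\<And>y z. M > 0 \<Longrightarrow> y \<noteq> 0 \<Longrightarrow> \<bar>y\<bar> \<le> \<bar>z\<bar> \<Longrightarrow> f z \<le> f y"
    using distributed_prod_gauss_power[of "K - {i0}" i0 \<kappa> U b, unfolded i0(2) \<kappa>0 K(2), folded Z]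
      K(1) \<kappa> indep U by blast
  have \<sigma>: "\<sigma>M > 0" "sN > 0"
    unfolding \<sigma>M_def sN_def using assms(3,4) by (auto intro!: prod_pos)
  \<comment> \<open>\<open>A\<close> is the coefficient of \<open>z^2\<close> in the Meijer
    argument; its logarithm is the total shift in \<open>mellin_line\<close>.\<close>
  define A where "A = 2 ^ N * sN\<^sup>2 / (2 ^ M * \<sigma>M\<^sup>2)"
  have A: "A > 0"
    using \<sigma> by (simp add: A_def)
  have lnA: "(\<Sum>j\<in>K. \<kappa> j * b j) = ln A"
  proof -
    have "(\<Sum>i=1..M. ln (2 * (\<sigma>X i)\<^sup>2)) = ln (2 ^ M * \<sigma>M\<^sup>2)"
      using assms(3) by (subst ln_prod[symmetric])
        (auto simp: prod.distrib \<sigma>M_def prod_power_distrib less_imp_neq[symmetric])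
    moreover have "(\<Sum>j=1..N. ln (2 * (\<sigma>Y j)\<^sup>2)) = ln (2 ^ N * sN\<^sup>2)"
      using assms(4) by (subst ln_prod[symmetric])
        (auto simp: prod.distrib sN_def prod_power_distrib less_imp_neq[symmetric])
    ultimately show ?thesis
      using \<sigma> by (simp add: sum_K \<kappa>_def b_def sum_negf A_def ln_div)
  qed
  let ?C = "2 powr ((real N - real M) / 2) * sN / (pi powr ((real M + real N) / 2) * \<sigma>M)"
  have sqrtA: "sqrt A = 2 powr ((real N - real M) / 2) * sN / \<sigma>M"
  proof -
    have "2 powr ((real N - real M) / 2) = sqrt (2 ^ N) / sqrt (2 ^ M)"
      by (simp add: diff_divide_distrib powr_diff powr_half_sqrt_powr powr_realpow)
    then show ?thesis
      using \<sigma> by (simp add: A_def real_sqrt_divide real_sqrt_mult)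
  qed
  have pi: "sqrt pi ^ (M + N) = pi powr ((real M + real N) / 2)"
    by (simp add: powr_half_sqrt_powr powr_realpow real_sqrt_power flip: of_nat_add)
  \<comment> \<open>The prefactor combines \<open>sqrt pi\<close> from each factor with the
    \<open>sqrt A\<close> that the shift by \<open>1 / 2\<close> produces.\<close>
  have C: "?C = sqrt A / sqrt pi ^ (M + N)"
    unfolding sqrtA pi by simp
  have G: "of_real (f z) = of_real ?C *
      meijer_G M N (replicate N 0) (replicate M 0) (of_real (A * z\<^sup>2))" if z: "z \<noteq> 0" for z
  proof -
    let ?x = "A * z\<^sup>2"
    let ?F = "\<lambda>s. Gamma (- s) ^ M * Gamma (1 + s) ^ N * exp (s * of_real (ln ?x))"
    have x: "?x > 0"
      using A z by simp
    have C0: "?C \<noteq> 0"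
      using \<sigma> by simp
    have "meijer_G M N (replicate N 0) (replicate M 0) (of_real ?x) = of_real (f z) / of_real ?C"
    proof (rule meijer_G_replicate_0[OF x])
      fix c :: real assume c: "M > 0 \<Longrightarrow> c < 0" "N > 0 \<Longrightarrow> - 1 < c"
      let ?p = "\<lambda>t. Complex (c + 1 / 2) t"
      \<comment> \<open>With \<open>p = s + 1 / 2\<close>, admissibility means exactly
        \<open>c < 0\<close> for normal and \<open>- 1 < c\<close> for inverse normal
        factors.\<close>
      have adm: "\<forall>j\<in>K. \<kappa> j * (c + 1 / 2) < 1 / 2"
        using c by (auto simp: K_def \<kappa>_def)
      have p: "1 / 2 - ?p t = - Complex c t" "1 / 2 + ?p t = 1 + Complex c t" for t
        by (simp_all add: complex_eq_iff)
      have prod: "(\<Prod>j\<in>K. Gamma (1 / 2 - of_real (\<kappa> j) * ?p t)) =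
          Gamma (- Complex c t) ^ M * Gamma (1 + Complex c t) ^ N" for t
        unfolding prod_K by (simp add: \<kappa>_def p)
      have ln_x: "ln (z\<^sup>2) + (\<Sum>j\<in>K. \<kappa> j * b j) = ln ?x"
        unfolding lnA using A z by (simp add: ln_mult)
      \<comment> \<open>The shift splits off \<open>sqrt ?x = sqrt A * \<bar>z\<bar>\<close>, whose
        \<open>\<bar>z\<bar>\<close> cancels the one in \<open>rep\<close>.\<close>
      have exp: "exp (?p t * of_real (ln ?x)) = of_real (sqrt ?x) * exp (Complex c t * of_real (ln ?x))" for t
      proof -
        have "?p t * of_real (ln ?x) = of_real (ln ?x / 2) + Complex c t * of_real (ln ?x)"
          by (simp add: complex_eq_iff algebra_simps)
        moreover have "exp (ln ?x / 2) = sqrt ?x"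
          using x by (simp add: ln_sqrt[symmetric] del: real_sqrt_mult)
        ultimately show ?thesis
          by (simp only: exp_add exp_of_real)
      qed
      have "integrable lborel (\<lambda>t. \<Prod>j\<in>K. Gamma (1 / 2 - of_real (\<kappa> j) * ?p t))"
        using K i0(1) \<kappa> adm by (intro integrable_mellin_kernel) auto
      then have kint: "integrable lborel (\<lambda>t. Gamma (- Complex c t) ^ M * Gamma (1 + Complex c t) ^ N)"
        unfolding prod .
      have int: "integrable lborel (\<lambda>t. ?F (Complex c t))"
      proof (rule Bochner_Integration.integrable_bound)
        show "integrable lborel (\<lambda>t. of_real (exp (c * ln ?x)) *
            (Gamma (- Complex c t) ^ M * Gamma (1 + Complex c t) ^ N))"
          using kint by (rule integrable_mult_right)
        show "(\<lambda>t. ?F (Complex c t)) \<in> borel_measurable lborel"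
          using borel_measurable_integrable[OF kint] by measurable
        show "AE t in lborel. norm (?F (Complex c t)) \<le> norm (of_real (exp (c * ln ?x)) *
            (Gamma (- Complex c t) ^ M * Gamma (1 + Complex c t) ^ N))"
          by (intro always_eventually allI) (simp add: norm_mult)
      qed
      have "mellin_line \<kappa> b K (c + 1 / 2) z = of_real (sqrt ?x) * (LINT t|lborel. ?F (Complex c t))"
        unfolding mellin_line_def ln_x prod exp integral_mult_right_zero[symmetric]
        by (simp only: mult_ac)
      then have "of_real (\<bar>z\<bar> * f z) = of_real (1 / (sqrt pi ^ (M + N) * (2 * pi))) *
          (of_real (sqrt ?x) * (LINT t|lborel. ?F (Complex c t)))"
        using rep[OF z adm] by simp
      moreover have "sqrt ?x = sqrt A * \<bar>z\<bar>"
        by (simp add: real_sqrt_mult)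
      moreover define I where "I = (LINT t|lborel. ?F (Complex c t))"
      ultimately have "of_real \<bar>z\<bar> * of_real (f z) = of_real \<bar>z\<bar> * (of_real ?C * I / of_real (2 * pi))"
        unfolding C by simp
      then have "of_real (f z) = of_real ?C * I / of_real (2 * pi)"
        using z by (subst (asm) mult_left_cancel) auto
      then have "I = of_real (2 * pi) * (of_real (f z) / of_real ?C)"
        using C0 by (simp add: field_simps del: of_real_mult of_real_divide)
      with int show "integrable lborel (\<lambda>t. ?F (Complex c t)) \<and>
          (LINT t|lborel. ?F (Complex c t)) = of_real (2 * pi) * (of_real (f z) / of_real ?C)"
        unfolding I_def by simp
    qed
    then show ?thesis
      using C0 by simp
  qed
  have lim: "\<exists>L. ((\<lambda>z. ennreal (f z)) \<longlongrightarrow> L) (at 0)"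
  proof (cases "M > 0")
    case True
    then show ?thesis
      using tendsto_SUP_at_0[of "\<lambda>z. ennreal (f z)"] mono f by (auto intro!: ennreal_leI)
  next
    case False
    \<comment> \<open>For \<open>M = 0\<close> only inverse normal factors occur, so
      \<open>Re p = 3 / 2\<close>, that is \<open>Re s = 1\<close>, is admissible. There
      \<open>\<bar>z\<bar> * f z\<close> is at most \<open>D * \<bar>z\<bar>^3\<close>.\<close>
    define D where "D = (LINT t|lborel.
        norm (\<Prod>j\<in>K. Gamma (1 / 2 - of_real (\<kappa> j) * Complex (3 / 2) t))) * exp (3 / 2 * ln A) / (sqrt pi ^ (M + N) * (2 * pi))"
    have adm: "\<forall>j\<in>K. \<kappa> j * (3 / 2) < 1 / 2"
      using False by (auto simp: K_def \<kappa>_def)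
    have bound: "f z \<le> D * z\<^sup>2" if z: "z \<noteq> 0" for z
    proof -
      have "exp (3 / 2 * ln (z\<^sup>2)) = \<bar>z\<bar> * z\<^sup>2"
      proof -
        have "exp (3 / 2 * ln (z\<^sup>2)) = exp (ln (z\<^sup>2) / 2) * exp (ln (z\<^sup>2))"
          unfolding mult_exp_exp by (rule arg_cong[of _ _ exp]) simp
        then show ?thesis
          using z by (simp add: ln_sqrt[symmetric])
      qed
      moreover have "\<bar>z\<bar> * f z = norm (complex_of_real (\<bar>z\<bar> * f z))"
        unfolding norm_of_real using f by (simp add: abs_mult)
      ultimately have "\<bar>z\<bar> * f z \<le> \<bar>z\<bar> * (D * z\<^sup>2)"
        unfolding rep[OF z adm]
        using norm_mellin_line_le[of \<kappa> b K "3 / 2" z]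
        by (simp add: norm_mult norm_divide norm_power D_def lnA distrib_left exp_add divide_right_mono mult_ac)
      then show ?thesis
        using z by simp
    qed
    have "((\<lambda>z. D * z\<^sup>2) \<longlongrightarrow> D * 0\<^sup>2) (at 0)"
      by (intro tendsto_intros)
    then have "(f \<longlongrightarrow> 0) (at 0)"
      using f bound by (intro tendsto_sandwich[of "\<lambda>_. 0" f "at 0" "\<lambda>z. D * z\<^sup>2" 0])
        (auto simp: eventually_at_filter)
    then show ?thesis
      using tendsto_ennrealI by blast
  qed
  then obtain L where L: "((\<lambda>z. ennreal (f z)) \<longlongrightarrow> L) (at 0)" by blast
  \<comment> \<open>Changing the value at the single point 0 does not affect the
    distribution.\<close>
  define fZ where "fZ z = (if z = 0 then L else ennreal (f z))" for z
  have "AE z in lborel. ennreal (f z) = fZ z"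
    using nz by eventually_elim (simp add: fZ_def)
  then have "distributed P lborel Z fZ"
    using dist by (subst distributed_cong_density[symmetric]) (auto simp: fZ_def[abs_def])
  moreover have "(fZ \<longlongrightarrow> fZ 0) (at 0)"
    using L by (auto simp: fZ_def elim!: Lim_transform_eventually simp: eventually_at_filter)
  ultimately show ?thesis
    using G f unfolding A_def by (intro exI[of _ fZ]) (auto simp: fZ_def)
qed

end
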